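(* Let $d\ge 2$ and let $\mu$ be a probability measure on $\mathbb{R}^d$ that is absolutely continuous with respect to Lebesgue measure. Then there exist $2d-1$ pairwise distinct hyperplanes in $\mathbb{R}^d$, all containing a common $(d-2)$-flat, such that each of the $4d-2$ connected components of the complement of their union has $\mu$-measure exactly $\frac{1}{4d-2}$ (i.e., this $(2d-1)$-fan divides $\mu$ into $4d-2$ equal parts).
   Context: A $(d-2)$-flat is a $(d-2)$-dimensional affine subspace of $\mathbb{R}^d$. An $m$-fan is a set of $m$ hyperplanes in $\mathbb{R}^d$ that all pass through a common $(d-2)$-flat; $m$ distinct such hyperplanes cut $\mathbb{R}^d$ into $2m$ wedge-shaped parts. *)

theory Defs
  imports "HOL-Probability.Probability"
begin

definition is_hyperplane :: "'a::euclidean_space set \<Rightarrow> bool" where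
  "is_hyperplane S \<longleftrightarrow> (\<exists>a b. a \<noteq> 0 \<and> S = {x. a \<bullet> x = b})"

definition is_flat :: "int \<Rightarrow> 'a::euclidean_space set \<Rightarrow> bool" where
  "is_flat k F \<longleftrightarrow> affine F \<and> aff_dim F = k"

end

theory Submission
  imports Defs "HOL-Library.Z2"
begin

text \<open>
  Put $n = 2d - 1$. A fan is given by a pair $p = (U, V)$ of affine functionals, that is, of nonzero
  vectors in $\mathbb{R}^{d+1}$: its hyperplanes belong to the pencil $\sin\theta\, V - \cos\theta\, U = 0$.
  Choose $0 = \theta_0 < \theta_1 < \dots < \theta_n = \pi$ such that consecutive hyperplanes bound double
  wedges of measure $1/n$, and let $c_i$ be the difference of the measures of the two halves of the
  $i$-th double wedge. Replacing $V$ by $-V$ turns $c_i$ into $c_{n+1-i}$, and replacing $p$ by $-p$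
  turns $c_i$ into $-c_i$. Hence the $d$ functions $c_i + c_{n+1-i}$ are odd in $U$ and even in $V$, the
  $d - 1$ functions $c_i - c_{n+1-i}$ are even in $U$ and odd in $V$, and $\langle U, V\rangle$ is odd in
  both. A common zero is a fan that divides the measure into equal parts.

  Such a zero exists by a Borsuk--Ulam theorem for $S^d \times S^d$, because the coefficient of
  $x^d y^d$ in $x^d\, y^{d-1} (x + y)$ is odd. To prove that theorem, the cup product of the coboundaries of
  the signs of the $2d$ functions is evaluated on a chain of dimension $2d$ by moving one coboundary at a time to the
  boundary of the chain. The result is the coefficient, so after fine subdivision some small simplex
  carries a sign change of every function.
\<close>

subsection \<open>Chains and cochains modulo 2\<close>

declare add_bit_eq_xor [simp del] mult_bit_eq_and [simp del] bit_not_zero_iff [simp del] bit_not_one_iff [simp del]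

lemma bit_double [simp]: "a + a = (0::bit)" "a + (a + b) = (b::bit)"
  by (cases a; simp flip: add.assoc)+

text \<open>A simplex is the list of its vertices, a chain modulo 2 is a list of simplices, and a cochain
  is a function on simplices. Chains are compared only through their pairing with cochains.\<close>

definition ev :: "('p list \<Rightarrow> bit) \<Rightarrow> 'p list list \<Rightarrow> bit" where
  "ev \<phi> c = (\<Sum>t\<leftarrow>c. \<phi> t)"

lemma ev_Nil [simp]: "ev \<phi> [] = 0"
  and ev_Cons [simp]: "ev \<phi> (t # c) = \<phi> t + ev \<phi> c"
  and ev_append [simp]: "ev \<phi> (c @ c') = ev \<phi> c + ev \<phi> c'"
  and ev_map [simp]: "ev \<phi> (map f c) = ev (\<lambda>t. \<phi> (f t)) c"
  by (simp_all add: ev_def o_def)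

lemma ev_concat_map: "ev \<phi> (concat (map f c)) = ev (\<lambda>t. ev \<phi> (f t)) c"
  by (induction c) simp_all

lemma ev_add: "ev (\<lambda>t. \<phi> t + \<psi> t) c = ev \<phi> c + ev \<psi> c"
  by (induction c) (simp_all add: algebra_simps)

lemma ev_scale: "ev (\<lambda>t. a * \<phi> t) c = a * ev \<phi> c"
  by (induction c) (simp_all add: algebra_simps)

lemma ev_cong: "(\<And>t. t \<in> set c \<Longrightarrow> \<phi> t = \<psi> t) \<Longrightarrow> ev \<phi> c = ev \<psi> c"
  by (induction c) simp_all

lemma ev_zero [simp]: "ev (\<lambda>t. 0) c = 0"
  by (induction c) simp_all

lemma ev_nonzero: "ev \<phi> c \<noteq> 0 \<Longrightarrow> \<exists>t\<in>set c. \<phi> t \<noteq> 0"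
  using ev_cong[of c \<phi> "\<lambda>_. 0"] by fastforce

fun bd :: "'p list \<Rightarrow> 'p list list" where
  "bd [] = []"
| "bd (v # t) = t # map (Cons v) (bd t)"

lemma bd_bd: "ev (\<lambda>s. ev \<phi> (bd s)) (bd t) = 0"
  by (induction t arbitrary: \<phi>) (simp_all add: ev_add)

lemma bd_map: "bd (map f t) = map (map f) (bd t)"
  by (induction t) simp_all

lemma bd_length: "s \<in> set (bd t) \<Longrightarrow> Suc (length s) = length t"
  by (induction t arbitrary: s) auto

lemma bd_set: "s \<in> set (bd t) \<Longrightarrow> set s \<subseteq> set t"
  by (induction t arbitrary: s) fastforce+

subsection \<open>Cup products\<close>

text \<open>The arguments of the cup product are 0-cochains (sign functions) whose coboundaries are
  multiplied; in cup0 the first factor is used without coboundary, so that cup0 is a primitive of cup.\<close>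

fun cup :: "('p \<Rightarrow> bit) list \<Rightarrow> 'p list \<Rightarrow> bit" where
  "cup [] t = (if length t = 1 then 1 else 0)"
| "cup (\<sigma> # ss) (p # q # t) = (\<sigma> p + \<sigma> q) * cup ss (q # t)"
| "cup (\<sigma> # ss) _ = 0"

fun cup0 :: "('p \<Rightarrow> bit) \<Rightarrow> ('p \<Rightarrow> bit) list \<Rightarrow> 'p list \<Rightarrow> bit" where
  "cup0 \<sigma> ss [] = 0"
| "cup0 \<sigma> ss (p # t) = \<sigma> p * cup ss (p # t)"

lemma cup_Nil_list [simp]: "cup ss [] = 0"
  by (cases ss) simp_all

text \<open>Applying the assumption to \<open>p # s\<close> shows that the faces of
  \<open>t = p # s\<close> containing \<open>p\<close> contribute
  \<open>\<sigma> p * cup ss s\<close>. The remaining face \<open>s\<close> contributes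
  \<open>\<sigma> q * cup ss s\<close>, where \<open>q\<close> is its first vertex.\<close>

lemma cup_cocycle_imp_coboundary:
  assumes "\<And>t. ev (cup ss) (bd t) = 0"
  shows "ev (cup0 \<sigma> ss) (bd t) = cup (\<sigma> # ss) t"
proof (cases t)
  case (Cons p s)
  show ?thesis
  proof (cases s)
    case (Cons q r)
    have "cup ss s = ev (\<lambda>u. cup ss (p # u)) (bd s)"
      using assms[of "p # s"] by (simp add: eq_neg_iff_add_eq_0[symmetric])
    then show ?thesis
      using \<open>t = p # s\<close> Cons by (simp add: ev_scale algebra_simps)
  qed (use \<open>t = p # s\<close> in simp)
qed simp

text \<open>A product with one more factor is a coboundary by the previous lemma, and the boundary
  of a boundary vanishes. The empty product is the cochain 1 on vertices, and an edge has two
  ends.\<close>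

lemma cup_cocycle: "ev (cup ss) (bd t) = 0"
proof (induction ss arbitrary: t)
  case Nil
  show ?case
  proof (cases "length t \<le> 2")
    case True
    then consider "t = []" | p where "t = [p]" | p q where "t = [p, q]"
      by (cases t; cases "tl t") (auto simp: le_Suc_eq)
    then show ?thesis by cases auto
  next
    case False
    have "ev (cup []) (bd t) = ev (\<lambda>_. 0) (bd t)"
      by (rule ev_cong) (use False bd_length[of _ t] in force)
    then show ?thesis by (simp only: ev_zero)
  qed
next
  case (Cons \<sigma> ss)
  have "ev (cup (\<sigma> # ss)) (bd t) = ev (\<lambda>s. ev (cup0 \<sigma> ss) (bd s)) (bd t)"
    by (intro ev_cong cup_cocycle_imp_coboundary[symmetric] Cons)
  then show ?case by (simp add: bd_bd)
qed

lemmas cup_coboundary = cup_cocycle_imp_coboundary[OF cup_cocycle]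

text \<open>Only differences of values of each sign function enter the product. The antipodal maps
  will shift each sign function by a constant, so they preserve it.\<close>

lemma cup_map:
  assumes "\<And>\<sigma> p q. \<sigma> \<in> set ss \<Longrightarrow> p \<in> set t \<Longrightarrow> q \<in> set t \<Longrightarrow> \<sigma> (T p) + \<sigma> (T q) = \<sigma> p + \<sigma> q"
  shows "cup ss (map T t) = cup ss t"
  using assms
proof (induction ss t rule: cup.induct)
  case (2 \<sigma> ss p q t)
  have "cup ss (map T (q # t)) = cup ss (q # t)"
    by (intro 2(1) 2(2)) simp_all
  moreover have "\<sigma> (T p) + \<sigma> (T q) = \<sigma> p + \<sigma> q"
    by (rule 2(2)) simp_all
  ultimately show ?case by simp
next
  case (1 t)
  show ?case by simp
next
  case ("3_1" \<sigma> ss)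
  show ?case by simp
next
  case ("3_2" \<sigma> ss v)
  show ?case by simp
qed

text \<open>Each factor is evaluated on an edge of \<open>t\<close>. This is how a nonvanishing
  pairing yields a simplex on which every sign function takes both values.\<close>

lemma cup_nonzero:
  assumes "cup ss t \<noteq> 0" "\<sigma> \<in> set ss"
  shows "\<exists>p\<in>set t. \<exists>q\<in>set t. \<sigma> p \<noteq> \<sigma> q"
  using assms
proof (induction ss t rule: cup.induct)
  case (2 \<tau> ss p q t)
  from 2(2) have *: "\<tau> p + \<tau> q \<noteq> 0" "cup ss (q # t) \<noteq> 0"
    by auto
  show ?case
  proof (cases "\<sigma> = \<tau>")
    case True
    then have "\<sigma> p \<noteq> \<sigma> q" using *(1) by (metis bit_double(1))
    then show ?thesis by (intro bexI[of _ p] bexI[of _ q]) simp_all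
  next
    case False
    then have "\<exists>p\<in>set (q # t). \<exists>q\<in>set (q # t). \<sigma> p \<noteq> \<sigma> q"
      using 2(3) by (intro 2(1) *(2)) simp
    then show ?thesis by (meson list.set_intros(2))
  qed
qed simp_all

subsection \<open>Barycentric subdivision\<close>

definition bary :: "'p::real_vector list \<Rightarrow> 'p" where
  "bary t = (1 / real (length t)) *\<^sub>R sum_list t"

text \<open>The empty simplex goes to the chain consisting of the empty simplex, not to the empty
  chain; this makes a single vertex its own subdivision.\<close>

function sd :: "'p::real_vector list \<Rightarrow> 'p list list" where
  "sd t = (if t = [] then [[]] else map (Cons (bary t)) (concat (map sd (bd t))))"
  by auto
termination by (relation "Wellfounded.measure length") (auto dest: bd_length)

declare sd.simps [simp del]

lemma sd_Nil [simp]: "sd [] = [[]]"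
  by (simp add: sd.simps)

lemma ev_sd: "t \<noteq> [] \<Longrightarrow> ev \<phi> (sd t) = ev (\<lambda>s. ev (\<lambda>u. \<phi> (bary t # u)) (sd s)) (bd t)"
  by (subst sd.simps) (simp add: ev_concat_map)

text \<open>The boundary of the cone from \<open>bary t\<close> is its base, the subdivided boundary
  of \<open>t\<close>, plus the cone over the boundary of the base. By induction the latter comes
  from subdividing the boundary of the boundary of \<open>t\<close>, which vanishes.\<close>

lemma bd_sd: "ev (\<lambda>s. ev \<phi> (bd s)) (sd t) = ev (\<lambda>s. ev \<phi> (sd s)) (bd t)"
proof (induction t arbitrary: \<phi> rule: measure_induct_rule[of length])
  case (less t)
  show ?case
  proof (cases "t = []")
    case False
    let ?\<psi> = "\<lambda>u. \<phi> (bary t # u)"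
    have "ev (\<lambda>s. ev \<phi> (bd s)) (sd t) =
        ev (\<lambda>s. ev \<phi> (sd s)) (bd t) + ev (\<lambda>s. ev (\<lambda>u. ev ?\<psi> (bd u)) (sd s)) (bd t)"
      using False by (simp add: ev_sd ev_add)
    also have "ev (\<lambda>s. ev (\<lambda>u. ev ?\<psi> (bd u)) (sd s)) (bd t) = ev (\<lambda>s. ev (\<lambda>u. ev ?\<psi> (sd u)) (bd s)) (bd t)"
      by (intro ev_cong less) (use bd_length in fastforce)
    finally show ?thesis by (simp add: bd_bd)
  qed simp
qed

lemma bary_map: "linear f \<Longrightarrow> bary (map f t) = f (bary t)"
proof -
  assume f: "linear f"
  have "sum_list (map f t) = f (sum_list t)"
    by (induction t) (simp_all add: linear_0[OF f] linear_add[OF f])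
  then show ?thesis by (simp add: bary_def linear_cmul[OF f])
qed

lemma sd_map: "linear f \<Longrightarrow> sd (map f t) = map (map f) (sd t)"
proof (induction t rule: measure_induct_rule[of length])
  case (less t)
  show ?case
  proof (cases "t = []")
    case False
    have "map (\<lambda>x. map (Cons (f (bary t))) (sd (map f x))) (bd t) =
        map (\<lambda>x. map (\<lambda>y. f (bary t) # map f y) (sd x)) (bd t)"
      using less by (auto dest: bd_length)
    then show ?thesis using False less(2)
      by (subst (1 2) sd.simps) (simp add: bd_map bary_map map_concat o_def cong: map_cong)
  qed simp
qed

lemma sd_length: "s \<in> set (sd t) \<Longrightarrow> length s = length t"
proof (induction t arbitrary: s rule: measure_induct_rule[of length])
  case (less t)
  show ?case
  proof (cases "t = []")
    case False
    with less(2) obtain u v where "u \<in> set (bd t)" "v \<in> set (sd u)" "s = bary t # v"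
      by (subst (asm) sd.simps) auto
    then show ?thesis using less(1)[of u v] bd_length[of u t] by simp
  qed (use less(2) in simp)
qed

lemma bary_in_hull:
  assumes "t \<noteq> []" shows "bary t \<in> convex hull (set t)"
proof -
  have "bary t = (\<Sum>i<length t. (1 / real (length t)) *\<^sub>R t ! i)"
    by (simp add: bary_def sum_list_sum_nth atLeast0LessThan scaleR_sum_right)
  also have "\<dots> \<in> convex hull (set t)"
    using assms by (intro convex_sum) (auto intro!: hull_inc)
  finally show ?thesis .
qed

lemma sd_hull: "s \<in> set (sd t) \<Longrightarrow> set s \<subseteq> convex hull (set t)"
proof (induction t arbitrary: s rule: measure_induct_rule[of length])
  case (less t)
  show ?case
  proof (cases "t = []")
    case False
    with less(2) obtain u v where uv: "u \<in> set (bd t)" "v \<in> set (sd u)" "s = bary t # v"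
      by (subst (asm) sd.simps) auto
    have "set v \<subseteq> convex hull (set u)"
      using less(1) uv bd_length[OF uv(1)] by auto
    also have "\<dots> \<subseteq> convex hull (set t)"
      by (intro hull_mono bd_set uv)
    finally show ?thesis using uv False by (auto intro: bary_in_hull)
  qed (use less(2) in simp)
qed

text \<open>The vector \<open>bary t - v\<close> is the average of the vectors from \<open>v\<close>
  to the vertices, and the one for \<open>v\<close> itself is zero. That missing term gives the
  factor below 1.\<close>

lemma dist_bary:
  fixes t :: "'p::real_normed_vector list"
  assumes t: "t \<noteq> []" and D: "\<And>p q. p \<in> set t \<Longrightarrow> q \<in> set t \<Longrightarrow> dist p q \<le> D" and v: "v \<in> set t"
  shows "dist (bary t) v \<le> (1 - 1 / real (length t)) * D"
proof -
  let ?n = "length t"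
  obtain j where j: "j < ?n" "v = t ! j" using v by (auto simp: in_set_conv_nth)
  have "bary t - v = (1 / real ?n) *\<^sub>R (\<Sum>i<?n. t ! i - v)"
    using t by (simp add: bary_def sum_list_sum_nth atLeast0LessThan sum_subtractf
        scaleR_diff_right scaleR_sum_right sum_constant_scaleR)
  also have "(\<Sum>i<?n. t ! i - v) = (\<Sum>i\<in>{..<?n} - {j}. t ! i - v)"
    using j by (simp add: sum.remove[of _ j])
  finally have "dist (bary t) v = (1 / real ?n) * norm (\<Sum>i\<in>{..<?n} - {j}. t ! i - v)"
    by (simp add: dist_norm)
  also have "norm (\<Sum>i\<in>{..<?n} - {j}. t ! i - v) \<le> of_nat (card ({..<?n} - {j})) * D"
    by (rule sum_norm_bound) (use D j in \<open>auto simp: dist_norm[symmetric]\<close>)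
  also have "of_nat (card ({..<?n} - {j})) = real ?n - 1"
    using j by (simp add: of_nat_diff Suc_leI)
  finally have "dist (bary t) v \<le> (1 / real ?n) * ((real ?n - 1) * D)"
    by (simp add: divide_right_mono)
  then show ?thesis using t
    by (simp add: of_nat_diff Suc_leI field_simps)
qed

text \<open>An upper bound \<open>L\<close> for the number of vertices lets the induction pass to
  faces. Two vertices of a small simplex either both come from the subdivision of a face, or one of
  them is \<open>bary t\<close>, and the claimed radius around it covers the whole hull.\<close>

lemma sd_mesh:
  fixes t :: "'p::real_normed_vector list"
  assumes "\<And>p q. p \<in> set t \<Longrightarrow> q \<in> set t \<Longrightarrow> dist p q \<le> D" "0 \<le> D" "length t \<le> L"
    "s \<in> set (sd t)" "p \<in> set s" "q \<in> set s"
  shows "dist p q \<le> (1 - 1 / real L) * D"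
  using assms
proof (induction t arbitrary: s p q rule: measure_induct_rule[of length])
  case (less t)
  show ?case
  proof (cases "t = []")
    case False
    with less.prems(4) obtain u v where uv: "u \<in> set (bd t)" "v \<in> set (sd u)" "s = bary t # v"
      by (subst (asm) sd.simps) auto
    have ut: "length u < length t" "set u \<subseteq> set t"
      using bd_length[OF uv(1)] bd_set[OF uv(1)] by simp_all
    let ?r = "(1 - 1 / real L) * D"
    have "(1 - 1 / real (length t)) * D \<le> ?r"
      using less.prems(2,3) False
      by (intro mult_right_mono[OF _ less.prems(2)] diff_left_mono divide_left_mono) (auto simp: le_eq_less_or_eq)
    then have "set t \<subseteq> cball (bary t) ?r"
      using order.trans[OF dist_bary[of t D, OF False less.prems(1)]] by (intro subsetI) simp
    then have "convex hull (set t) \<subseteq> cball (bary t) ?r"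
      by (intro hull_minimal convex_cball)
    then have A: "dist (bary t) x \<le> ?r" if "x \<in> set s" for x
      using sd_hull[OF less.prems(4)] that by (auto simp: subset_iff)
    moreover have "dist x y \<le> ?r" if "x \<in> set v" "y \<in> set v" for x y
      by (rule less.IH[OF ut(1) _ less.prems(2) _ uv(2) that])
        (use ut in \<open>blast intro: less.prems(1)\<close>, use ut less.prems(3) in linarith)
    moreover have "0 \<le> ?r"
      by (rule order.trans[OF zero_le_dist A[of "bary t"]]) (simp add: uv(3))
    moreover have "p = bary t \<or> p \<in> set v" "q = bary t \<or> q \<in> set v"
      using less.prems(5,6) uv(3) by simp_all
    ultimately show ?thesis
      using A[of p] A[of q] less.prems(5,6) by (elim disjE) (simp_all add: dist_commute[of _ "bary t"])
  qed (use less.prems(4,5) in simp)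
qed

section \<open>Antipodal maps and products of cross-polytope hemispheres\<close>

definition neg1 :: "'e::real_vector \<times> 'e \<Rightarrow> 'e \<times> 'e" where "neg1 p = (- fst p, snd p)"
definition neg2 :: "'e::real_vector \<times> 'e \<Rightarrow> 'e \<times> 'e" where "neg2 p = (fst p, - snd p)"

lemma neg_simps [simp]:
  "neg1 (neg1 p) = p" "neg2 (neg2 p) = p" "neg1 (neg2 p) = neg2 (neg1 p)"
  "fst (neg1 p) = - fst p" "snd (neg1 p) = snd p" "fst (neg2 p) = fst p" "snd (neg2 p) = - snd p"
  "neg1 \<circ> neg1 = id" "neg2 \<circ> neg2 = id" "neg1 \<circ> neg2 = neg2 \<circ> neg1"
  by (auto simp: neg1_def neg2_def)

lemma linear_neg: "linear neg1" "linear neg2"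
  by (auto intro!: linearI simp: neg1_def neg2_def prod_eq_iff)

text \<open>The operator 1 + T on cochains, with \<open>double\<close> as its adjoint on chains. For
  an involution it squares to zero modulo 2.\<close>

definition orbit_sum :: "('p \<Rightarrow> 'p) \<Rightarrow> ('p list \<Rightarrow> bit) \<Rightarrow> 'p list \<Rightarrow> bit" where
  "orbit_sum T \<phi> = (\<lambda>t. \<phi> t + \<phi> (map T t))"

definition double :: "('p \<Rightarrow> 'p) \<Rightarrow> 'p list list \<Rightarrow> 'p list list" where
  "double T c = c @ map (map T) c"

lemma ev_double: "ev \<phi> (double T c) = ev (orbit_sum T \<phi>) c"
  by (simp add: double_def orbit_sum_def ev_add)

lemma orbit_sum_add: "orbit_sum T (\<lambda>t. \<phi> t + \<psi> t) = (\<lambda>t. orbit_sum T \<phi> t + orbit_sum T \<psi> t)"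
  by (simp add: orbit_sum_def fun_eq_iff algebra_simps)

lemma orbit_sum_bd: "orbit_sum T (\<lambda>t. ev \<phi> (bd t)) = (\<lambda>t. ev (orbit_sum T \<phi>) (bd t))"
  by (simp add: orbit_sum_def fun_eq_iff bd_map ev_add)

lemma orbit_sum_tw: "orbit_sum neg1 (orbit_sum neg1 \<phi>) = (\<lambda>_. 0)" "orbit_sum neg2 (orbit_sum neg2 \<phi>) = (\<lambda>_. 0)"
  by (auto simp: orbit_sum_def fun_eq_iff algebra_simps)

lemma orbit_sum_commute: "orbit_sum neg2 (orbit_sum neg1 \<phi>) = orbit_sum neg1 (orbit_sum neg2 \<phi>)"
  by (auto simp: orbit_sum_def fun_eq_iff algebra_simps)

text \<open>A triangulation of the product of two hemispheres of cross-polytopes, of dimensions k and l,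
  obtained by coning: modulo 2, its boundary consists of both copies (under the antipodal map of
  the respective factor) of the products in which one dimension has dropped by one.\<close>

fun hemi :: "(nat \<Rightarrow> 'e::real_vector) \<Rightarrow> nat \<Rightarrow> nat \<Rightarrow> ('e \<times> 'e) list list" where
  "hemi e 0 0 = [[(e 0, e 0)]]"
| "hemi e (Suc k) 0 = map (Cons (e (Suc k), e 0)) (double neg1 (hemi e k 0))"
| "hemi e 0 (Suc l) = map (Cons (e 0, e (Suc l))) (double neg2 (hemi e 0 l))"
| "hemi e (Suc k) (Suc l) = map (Cons (e (Suc k), e (Suc l)))
     (double neg1 (hemi e k (Suc l)) @ double neg2 (hemi e (Suc k) l))"

text \<open>Evaluation on the expected boundary of \<open>hemi e k l\<close>. In positive dimension
  the same chain is the base of that cone.\<close>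

definition bnd :: "(nat \<Rightarrow> 'e::real_vector) \<Rightarrow> nat \<Rightarrow> nat \<Rightarrow> (('e \<times> 'e) list \<Rightarrow> bit) \<Rightarrow> bit" where
  "bnd e k l \<phi> = (case k of 0 \<Rightarrow> 0 | Suc k' \<Rightarrow> ev (orbit_sum neg1 \<phi>) (hemi e k' l))
     + (case l of 0 \<Rightarrow> 0 | Suc l' \<Rightarrow> ev (orbit_sum neg2 \<phi>) (hemi e k l'))"

lemma ev_hemi: "k + l > 0 \<Longrightarrow> ev \<phi> (hemi e k l) = bnd e k l (\<lambda>t. \<phi> ((e k, e l) # t))"
  by (cases k; cases l) (simp_all add: bnd_def ev_double)

lemma bnd_add: "bnd e k l (\<lambda>t. \<phi> t + \<psi> t) = bnd e k l \<phi> + bnd e k l \<psi>"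
  by (cases k; cases l) (simp_all add: bnd_def orbit_sum_add ev_add algebra_simps)

text \<open>The boundary of a cone is its base plus the cone over the boundary of the base, so it
  suffices that the base is a cycle.\<close>

lemma hemi_boundary: "k + l > 0 \<Longrightarrow> ev (\<lambda>t. ev \<phi> (bd t)) (hemi e k l) = bnd e k l \<phi>"
proof (induction "k + l" arbitrary: k l \<phi> rule: less_induct)
  case less
  define \<psi> where "\<psi> = (\<lambda>t. \<phi> ((e k, e l) # t))"
  \<comment> \<open>In the boundary of the base, terms with the same map twice vanish because
    \<open>orbit_sum\<close> squares to zero, and the mixed term occurs twice. If a lower product is
    a point, its boundary is the empty simplex, which cancels with its copy.\<close>
  have "bnd e k l (\<lambda>t. ev \<psi> (bd t)) = 0"
  proof -
    have 1: "ev (\<lambda>t. ev (orbit_sum neg1 \<psi>) (bd t)) (hemi e k' l) =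
        (case l of 0 \<Rightarrow> 0 | Suc l' \<Rightarrow> ev (orbit_sum neg1 (orbit_sum neg2 \<psi>)) (hemi e k' l'))" if "k = Suc k'" for k'
    proof (cases "k' + l > 0")
      case True
      then show ?thesis using less(1)[of k' l "orbit_sum neg1 \<psi>"] that
        by (cases k'; cases l) (simp_all add: bnd_def orbit_sum_tw orbit_sum_commute)
    qed (simp add: orbit_sum_def)
    have 2: "ev (\<lambda>t. ev (orbit_sum neg2 \<psi>) (bd t)) (hemi e k l') =
        (case k of 0 \<Rightarrow> 0 | Suc k' \<Rightarrow> ev (orbit_sum neg1 (orbit_sum neg2 \<psi>)) (hemi e k' l'))" if "l = Suc l'" for l'
    proof (cases "k + l' > 0")
      case True
      then show ?thesis using less(1)[of k l' "orbit_sum neg2 \<psi>"] that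
        by (cases l'; cases k) (simp_all add: bnd_def orbit_sum_tw orbit_sum_commute)
    qed (simp add: orbit_sum_def)
    show ?thesis
      unfolding bnd_def orbit_sum_bd using 1[of "k - 1"] 2[of "l - 1"]
      by (cases k; cases l) simp_all
  qed
  moreover have "ev (\<lambda>t. ev \<phi> (bd t)) (hemi e k l) = bnd e k l (\<lambda>t. \<phi> t + ev \<psi> (bd t))"
    by (simp add: ev_hemi[OF less(2)] \<psi>_def)
  ultimately show ?case by (simp add: bnd_add)
qed

lemma hemi_length: "t \<in> set (hemi e k l) \<Longrightarrow> length t = Suc (k + l)"
  by (induction e k l arbitrary: t rule: hemi.induct) (force simp: double_def)+

text \<open>The functional \<open>a\<close> keeps the convex hull of \<open>S\<close> off the
  origin; the vanishing of the later coordinates leaves room to adjust \<open>a\<close> when the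
  next vertex is added.\<close>

definition hemi_set :: "(nat \<Rightarrow> 'e::euclidean_space) \<Rightarrow> nat \<Rightarrow> nat \<Rightarrow> 'e set \<Rightarrow> bool" where
  "hemi_set e n k S \<longleftrightarrow> (\<exists>a. a \<bullet> e k = 1 \<and> (\<forall>x\<in>S. a \<bullet> x = 1)) \<and> (\<forall>x\<in>S. \<forall>i. k < i \<and> i < n \<longrightarrow> x \<bullet> e i = 0)"

context
  fixes e :: "nat \<Rightarrow> 'e::euclidean_space" and n :: nat
  assumes ortho: "\<And>i j. i < n \<Longrightarrow> j < n \<Longrightarrow> e i \<bullet> e j = (if i = j then 1 else 0)"
begin

lemma hemi_set_insert: "k < n \<Longrightarrow> hemi_set e n k S \<Longrightarrow> hemi_set e n k (insert (e k) S)"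
  unfolding hemi_set_def using ortho by auto

text \<open>Adding a multiple of \<open>e (Suc k)\<close> to the functional does not affect its
  values on \<open>S\<close>, but makes its value at \<open>e (Suc k)\<close> equal to 1. The sign
  \<open>c = -1\<close> serves the reflected set.\<close>

lemma hemi_set_uminus: "hemi_set e n k S \<Longrightarrow> Suc k < n \<Longrightarrow> hemi_set e n (Suc k) (uminus ` S)"
  and hemi_set_Suc: "hemi_set e n k S \<Longrightarrow> Suc k < n \<Longrightarrow> hemi_set e n (Suc k) S"
proof -
  assume S: "hemi_set e n k S" and k: "Suc k < n"
  obtain a where a: "\<forall>x\<in>S. a \<bullet> x = 1" and 0: "\<And>x i. x \<in> S \<Longrightarrow> k < i \<Longrightarrow> i < n \<Longrightarrow> x \<bullet> e i = 0"
    using S unfolding hemi_set_def by blast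
  have *: "\<exists>b. b \<bullet> e (Suc k) = 1 \<and> (\<forall>x\<in>S. b \<bullet> x = c)" if "c = 1 \<or> c = -1" for c :: real
  proof (intro exI conjI ballI)
    let ?b = "c *\<^sub>R a + (1 - (c *\<^sub>R a) \<bullet> e (Suc k)) *\<^sub>R e (Suc k)"
    show "?b \<bullet> e (Suc k) = 1"
      using ortho[OF k k] by (simp add: inner_add_left)
    show "?b \<bullet> x = c" if "x \<in> S" for x
      using a that 0[OF that, of "Suc k"] k by (simp add: inner_add_left inner_commute[of "e (Suc k)"])
  qed
  show "hemi_set e n (Suc k) S"
    using *[of 1] 0 unfolding hemi_set_def by auto
  show "hemi_set e n (Suc k) (uminus ` S)"
    using *[of "-1"] 0 unfolding hemi_set_def by auto
qed

lemma hemi_hemi_set: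
  "t \<in> set (hemi e k l) \<Longrightarrow> k < n \<Longrightarrow> l < n \<Longrightarrow> hemi_set e n k (fst ` set t) \<and> hemi_set e n l (snd ` set t)"
proof (induction "k + l" arbitrary: k l t rule: less_induct)
  case less
  have "\<exists>s. t = (e k, e l) # s \<and> hemi_set e n k (fst ` set s) \<and> hemi_set e n l (snd ` set s)"
  proof (cases "k + l > 0")
    case True
    have 1: "hemi_set e n k (fst ` set s) \<and> hemi_set e n l (snd ` set s)"
      if "k = Suc k'" "u \<in> set (hemi e k' l)" "s = u \<or> s = map neg1 u" for k' s u
    proof -
      have "fst ` neg1 ` A = uminus ` fst ` A" "snd ` neg1 ` A = snd ` A" for A :: "('e \<times> 'e) set"
        by (simp_all add: image_image)
      then show ?thesis
        using that less(1)[of k' l u] less(3,4) hemi_set_uminus[of k' "fst ` set u"] hemi_set_Suc[of k' "fst ` set u"]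
        by auto
    qed
    have 2: "hemi_set e n k (fst ` set s) \<and> hemi_set e n l (snd ` set s)"
      if "l = Suc l'" "u \<in> set (hemi e k l')" "s = u \<or> s = map neg2 u" for l' s u
    proof -
      have "fst ` neg2 ` A = fst ` A" "snd ` neg2 ` A = uminus ` snd ` A" for A :: "('e \<times> 'e) set"
        by (simp_all add: image_image)
      then show ?thesis
        using that less(1)[of k l' u] less(3,4) hemi_set_uminus[of l' "snd ` set u"] hemi_set_Suc[of l' "snd ` set u"]
        by auto
    qed
    obtain s where s: "t = (e k, e l) # s" and
      "(\<exists>k' u. k = Suc k' \<and> u \<in> set (hemi e k' l) \<and> (s = u \<or> s = map neg1 u)) \<or>
       (\<exists>l' u. l = Suc l' \<and> u \<in> set (hemi e k l') \<and> (s = u \<or> s = map neg2 u))"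
      using True less(2) by (cases k; cases l) (auto simp: double_def)
    then have "hemi_set e n k (fst ` set s) \<and> hemi_set e n l (snd ` set s)"
      by (elim disjE exE conjE) (rule 1 2, assumption+, simp)+
    then show ?thesis using s by simp
  next
    case False
    then have "hemi_set e n k {}" "hemi_set e n l {}"
      using ortho[of 0 0] less(3) by (auto simp: hemi_set_def intro!: exI[of _ "e 0"])
    then show ?thesis using less(2) False by auto
  qed
  then obtain s where s: "t = (e k, e l) # s" "hemi_set e n k (fst ` set s)" "hemi_set e n l (snd ` set s)"
    by blast
  show ?case
    using hemi_set_insert[OF less(3) s(2)] hemi_set_insert[OF less(4) s(3)] by (simp add: s(1))
qed

text \<open>A functional equal to 1 on all vertices is 1 on their hull. Hence subdivision stays in
  the region where the sign functions have their symmetries.\<close>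

lemma hemi_hull:
  assumes "t \<in> set (hemi e k l)" "k < n" "l < n" "p \<in> convex hull (set t)"
  shows "fst p \<noteq> 0" "snd p \<noteq> 0"
proof -
  obtain a where a: "\<forall>x\<in>fst ` set t. a \<bullet> x = 1"
    using hemi_hemi_set[OF assms(1-3), THEN conjunct1] unfolding hemi_set_def by (elim conjE exE)
  obtain b where b: "\<forall>y\<in>snd ` set t. b \<bullet> y = 1"
    using hemi_hemi_set[OF assms(1-3), THEN conjunct2] unfolding hemi_set_def by (elim conjE exE)
  let ?A = "{p. (a, 0) \<bullet> p = 1} \<inter> {p. (0, b) \<bullet> p = 1}"
  have "set t \<subseteq> ?A"
    using a b by (auto simp: inner_prod_def)
  then have "convex hull (set t) \<subseteq> ?A"
    by (intro hull_minimal convex_Int convex_hyperplane)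
  then have "p \<in> ?A" using assms(4) by (rule subsetD)
  then have "a \<bullet> fst p = 1" "b \<bullet> snd p = 1"
    by (simp_all add: inner_prod_def)
  then show "fst p \<noteq> 0" "snd p \<noteq> 0" by auto
qed

end

subsection \<open>Pulling cochains back along iterated subdivision\<close>

text \<open>The adjoint of subdivision: the chain stays fixed while the mesh shrinks.\<close>

definition pull :: "('p::real_vector list \<Rightarrow> bit) \<Rightarrow> 'p list \<Rightarrow> bit" where
  "pull \<phi> = (\<lambda>t. ev \<phi> (sd t))"

lemma pull_Suc: "(pull ^^ Suc r) \<phi> = (\<lambda>t. ev ((pull ^^ r) \<phi>) (sd t))"
proof -
  have "(pull ^^ Suc r) \<phi> = pull ((pull ^^ r) \<phi>)" by simp
  then show ?thesis by (simp only: pull_def)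
qed

lemma pull_bd: "(pull ^^ r) (\<lambda>t. ev \<phi> (bd t)) = (\<lambda>t. ev ((pull ^^ r) \<phi>) (bd t))"
proof (induction r)
  case (Suc r)
  then show ?case by (simp only: pull_Suc bd_sd)
qed simp

lemma orbit_sum_pull:
  assumes "linear T" shows "orbit_sum T ((pull ^^ r) \<phi>) = (pull ^^ r) (orbit_sum T \<phi>)"
proof -
  have "orbit_sum T (pull \<psi>) = pull (orbit_sum T \<psi>)" for \<psi>
    by (simp add: pull_def orbit_sum_def fun_eq_iff sd_map[OF assms] ev_add)
  then show ?thesis by (induction r) simp_all
qed

lemma pull_scale: "(pull ^^ r) (\<lambda>t. a * \<phi> t) = (\<lambda>t. a * (pull ^^ r) \<phi> t)"
  by (induction r) (simp, simp only: pull_Suc ev_scale)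

lemma pull_cong:
  assumes "convex C" "\<And>s. set s \<subseteq> C \<Longrightarrow> \<phi> s = \<psi> s" "set t \<subseteq> C"
  shows "(pull ^^ r) \<phi> t = (pull ^^ r) \<psi> t"
  using assms(3)
proof (induction r arbitrary: t)
  case (Suc r)
  have "set s \<subseteq> C" if "s \<in> set (sd t)" for s
    using sd_hull[OF that] hull_minimal[of "set t" C convex] Suc.prems assms(1) by blast
  then show ?case unfolding pull_Suc by (intro ev_cong Suc.IH)
qed (use assms(2) in simp)

text \<open>A nonzero sum has a nonzero term; choosing one at each level descends to a simplex of
  the iterated subdivision, with one mesh factor per level.\<close>

lemma pull_nonzero:
  fixes t :: "'p::real_normed_vector list"
  assumes "(pull ^^ r) \<phi> t \<noteq> 0" "length t = L"
    "\<And>p q. p \<in> set t \<Longrightarrow> q \<in> set t \<Longrightarrow> dist p q \<le> D" "0 \<le> D"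
  shows "\<exists>s. \<phi> s \<noteq> 0 \<and> set s \<subseteq> convex hull (set t) \<and> length s = L \<and>
    (\<forall>p\<in>set s. \<forall>q\<in>set s. dist p q \<le> (1 - 1 / real L) ^ r * D)"
  using assms
proof (induction r arbitrary: t D)
  case 0
  then show ?case by (intro exI[of _ t]) (auto simp: hull_inc)
next
  case (Suc r)
  have "ev ((pull ^^ r) \<phi>) (sd t) \<noteq> 0"
    using Suc.prems(1) by (simp only: pull_Suc not_False_eq_True)
  then obtain u where u: "u \<in> set (sd t)" "(pull ^^ r) \<phi> u \<noteq> 0"
    using ev_nonzero by blast
  let ?D = "(1 - 1 / real L) * D"
  \<comment> \<open>For \<open>L = 0\<close> the factor \<open>1 - 1 / real L\<close> is 1, since
    division by zero yields 0.\<close>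
  have "L = 0 \<or> L \<ge> 1" by linarith
  then have "0 \<le> ?D"
    using Suc.prems(4) by auto
  moreover have "length u = L" using sd_length[OF u(1)] Suc.prems(2) by simp
  moreover have "dist p q \<le> ?D" if "p \<in> set u" "q \<in> set u" for p q
    by (rule sd_mesh[OF Suc.prems(3,4) _ u(1) that]) (simp_all add: Suc.prems(2))
  ultimately obtain s where s: "\<phi> s \<noteq> 0" "set s \<subseteq> convex hull (set u)" "length s = L"
    "\<forall>p\<in>set s. \<forall>q\<in>set s. dist p q \<le> (1 - 1 / real L) ^ r * ?D"
    using Suc.IH[of u ?D] u(2) by blast
  have "convex hull (set u) \<subseteq> convex hull (set t)"
    using sd_hull[OF u(1)] by (intro hull_minimal convex_convex_hull)
  then show ?case
    using s by (intro exI[of _ s]) (auto simp: mult.assoc mult.commute)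
qed

subsection \<open>A Borsuk--Ulam theorem for products of spheres\<close>

text \<open>The coefficient of $x^k y^l$ in the product of the linear forms $a x + b y$ with $(a, b)$ from
  the list, over the field with two elements. A pair $(a, b)$ records the parity of a function under
  the two antipodal maps, and the product is the Euler class obstructing a common zero.\<close>

fun lf_coeff :: "(bit \<times> bit) list \<Rightarrow> nat \<Rightarrow> nat \<Rightarrow> bit" where
  "lf_coeff [] k l = (if k = 0 \<and> l = 0 then 1 else 0)"
| "lf_coeff (ab # w) k l = (case k of 0 \<Rightarrow> 0 | Suc k' \<Rightarrow> fst ab * lf_coeff w k' l)
     + (case l of 0 \<Rightarrow> 0 | Suc l' \<Rightarrow> snd ab * lf_coeff w k l')"

text \<open>Zero components are excluded because the corresponding antipodal map fixes such a point,
  which would force the parity 0.\<close>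

definition has_type :: "('e::euclidean_space \<times> 'e \<Rightarrow> bit) \<Rightarrow> bit \<times> bit \<Rightarrow> bool" where
  "has_type \<sigma> ab \<longleftrightarrow> (\<forall>p. fst p \<noteq> 0 \<longrightarrow> snd p \<noteq> 0 \<longrightarrow> \<sigma> (neg1 p) = \<sigma> p + fst ab \<and> \<sigma> (neg2 p) = \<sigma> p + snd ab)"

text \<open>Every factor of \<open>cup ss\<close> is a coboundary and thus invariant, so only the
  shift of the leading \<open>\<sigma>\<close> survives in the orbit sum.\<close>

lemma orbit_sum_cup0:
  assumes "list_all2 has_type (\<sigma> # ss) (ab # w)" "\<And>p. p \<in> set t \<Longrightarrow> fst p \<noteq> 0 \<and> snd p \<noteq> 0"
  shows "orbit_sum neg1 (cup0 \<sigma> ss) t = fst ab * cup ss t" "orbit_sum neg2 (cup0 \<sigma> ss) t = snd ab * cup ss t"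
proof -
  have *: "\<exists>cd. has_type \<tau> cd" if "\<tau> \<in> set ss" for \<tau>
    using assms(1) that by (fastforce simp: list_all2_conv_all_nth in_set_conv_nth simp del: split_paired_Ex)
  have 1: "cup ss (map neg1 t) = cup ss t"
  proof (rule cup_map)
    fix \<tau> p q assume "\<tau> \<in> set ss" "p \<in> set t" "q \<in> set t"
    with * assms(2) obtain c where "\<tau> (neg1 p) = \<tau> p + c" "\<tau> (neg1 q) = \<tau> q + c"
      unfolding has_type_def by meson
    then show "\<tau> (neg1 p) + \<tau> (neg1 q) = \<tau> p + \<tau> q" by (simp add: algebra_simps)
  qed
  have 2: "cup ss (map neg2 t) = cup ss t"
  proof (rule cup_map)
    fix \<tau> p q assume "\<tau> \<in> set ss" "p \<in> set t" "q \<in> set t"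
    with * assms(2) obtain c where "\<tau> (neg2 p) = \<tau> p + c" "\<tau> (neg2 q) = \<tau> q + c"
      unfolding has_type_def by meson
    then show "\<tau> (neg2 p) + \<tau> (neg2 q) = \<tau> p + \<tau> q" by (simp add: algebra_simps)
  qed
  have 3: "\<sigma> (neg1 p) = \<sigma> p + fst ab" "\<sigma> (neg2 p) = \<sigma> p + snd ab" if "p \<in> set t" for p
    using assms(1) assms(2)[OF that] unfolding has_type_def list_all2_Cons by blast+
  show "orbit_sum neg1 (cup0 \<sigma> ss) t = fst ab * cup ss t" "orbit_sum neg2 (cup0 \<sigma> ss) t = snd ab * cup ss t"
    using 1 2 3[of "hd t"] by (cases t; simp add: orbit_sum_def algebra_simps)+
qed

text \<open>The first coboundary moves to the boundary of the chain, a sum of doubled products, and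
  each doubling contributes a parity of the removed factor. This is the recursion of
  \<open>lf_coeff\<close>.\<close>

lemma cup_eval:
  fixes e :: "nat \<Rightarrow> 'e::euclidean_space"
  assumes ortho: "\<And>i j. i < n \<Longrightarrow> j < n \<Longrightarrow> e i \<bullet> e j = (if i = j then 1 else 0)"
  assumes "list_all2 has_type ss w" "k < n" "l < n" "length w = k + l"
  shows "ev ((pull ^^ r) (cup ss)) (hemi e k l) = lf_coeff w k l"
  using assms(2-)
proof (induction ss w arbitrary: k l rule: list_all2_induct)
  case Nil
  have "(pull ^^ r) (cup []) [p] = 1" for p :: "'e \<times> 'e"
    by (induction r) (simp, simp only: pull_Suc, simp add: sd.simps[of "[p]"] bary_def del: cup.simps)
  then show ?case using Nil by (simp del: cup.simps)
next
  case (Cons \<sigma> ss ab w)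
  have ty: "list_all2 has_type (\<sigma> # ss) (ab # w)" using Cons.hyps by simp
  have kl: "k + l > 0" using Cons.prems by (simp del: add_gr_0)
  let ?P = "pull ^^ r"
  have 1: "ev (orbit_sum neg1 (?P (cup0 \<sigma> ss))) (hemi e k' l') = fst ab * ev (?P (cup ss)) (hemi e k' l')"
    "ev (orbit_sum neg2 (?P (cup0 \<sigma> ss))) (hemi e k' l') = snd ab * ev (?P (cup ss)) (hemi e k' l')"
    if "k' < n" "l' < n" for k' l'
  proof -
    have "orbit_sum neg1 (?P (cup0 \<sigma> ss)) t = fst ab * ?P (cup ss) t"
      "orbit_sum neg2 (?P (cup0 \<sigma> ss)) t = snd ab * ?P (cup ss) t" if t: "t \<in> set (hemi e k' l')" for t
    proof -
      have "fst p \<noteq> 0 \<and> snd p \<noteq> 0" if "set s \<subseteq> convex hull (set t)" "p \<in> set s" for s p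
        using hemi_hull[OF ortho t \<open>k' < n\<close> \<open>l' < n\<close>] that by blast
      then have *: "orbit_sum neg1 (cup0 \<sigma> ss) s = fst ab * cup ss s" "orbit_sum neg2 (cup0 \<sigma> ss) s = snd ab * cup ss s"
        if "set s \<subseteq> convex hull (set t)" for s
        using that by (intro orbit_sum_cup0[OF ty]; blast)+
      show "orbit_sum neg1 (?P (cup0 \<sigma> ss)) t = fst ab * ?P (cup ss) t"
        unfolding orbit_sum_pull[OF linear_neg(1)] fun_cong[OF pull_scale, symmetric]
        by (rule pull_cong[OF convex_convex_hull *(1) hull_subset])
      show "orbit_sum neg2 (?P (cup0 \<sigma> ss)) t = snd ab * ?P (cup ss) t"
        unfolding orbit_sum_pull[OF linear_neg(2)] fun_cong[OF pull_scale, symmetric]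
        by (rule pull_cong[OF convex_convex_hull *(2) hull_subset])
    qed
    then show "ev (orbit_sum neg1 (?P (cup0 \<sigma> ss))) (hemi e k' l') = fst ab * ev (?P (cup ss)) (hemi e k' l')"
      "ev (orbit_sum neg2 (?P (cup0 \<sigma> ss))) (hemi e k' l') = snd ab * ev (?P (cup ss)) (hemi e k' l')"
      by (simp_all add: ev_scale[symmetric] cong: ev_cong)
  qed
  have "cup (\<sigma> # ss) = (\<lambda>t. ev (cup0 \<sigma> ss) (bd t))"
    by (simp add: cup_coboundary fun_eq_iff)
  then have "ev (?P (cup (\<sigma> # ss))) (hemi e k l) = bnd e k l (?P (cup0 \<sigma> ss))"
    by (simp add: pull_bd hemi_boundary[OF kl])
  also have "\<dots> = lf_coeff (ab # w) k l"
    unfolding bnd_def using Cons.prems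
    by (cases k; cases l) (simp_all add: 1 Cons.IH)
  finally show ?case .
qed

text \<open>An odd sign for nonzero vectors, used to break ties. The chosen coordinate depends only
  on which coordinates are nonzero, so \<open>x\<close> and \<open>- x\<close> share it.\<close>

definition lead_neg :: "'e::euclidean_space \<Rightarrow> bit" where
  "lead_neg x = (if x \<bullet> (SOME b. b \<in> Basis \<and> x \<bullet> b \<noteq> 0) < 0 then 1 else 0)"

lemma lead_neg_uminus: "x \<noteq> 0 \<Longrightarrow> lead_neg (- x) = lead_neg x + 1"
proof -
  assume "x \<noteq> 0"
  then have "\<exists>b. b \<in> Basis \<and> x \<bullet> b \<noteq> 0"
    using euclidean_all_zero_iff[of x] by blast
  then have "x \<bullet> (SOME b. b \<in> Basis \<and> x \<bullet> b \<noteq> 0) \<noteq> 0"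
    by (rule someI2_ex) blast
  then show ?thesis by (auto simp: lead_neg_def)
qed

definition parity_sign :: "bit \<Rightarrow> real" where
  "parity_sign c = (if c = 0 then 1 else - 1)"

text \<open>Ever finer subdivisions give simplices of shrinking diameter on which all sign functions
  change; by compactness they accumulate at a point, which is the common zero.\<close>

lemma common_zero_product_spheres:
  fixes f :: "nat \<Rightarrow> 'e::euclidean_space \<times> 'e \<Rightarrow> real"
  assumes len: "length w = 2 * (DIM('e) - 1)"
    and coeff: "lf_coeff w (DIM('e) - 1) (DIM('e) - 1) = 1"
    and cont: "\<And>i. i < length w \<Longrightarrow> continuous_on {p. fst p \<noteq> 0 \<and> snd p \<noteq> 0} (f i)"
    and sym1: "\<And>i p. i < length w \<Longrightarrow> fst p \<noteq> 0 \<Longrightarrow> snd p \<noteq> 0 \<Longrightarrow> f i (neg1 p) = parity_sign (fst (w ! i)) * f i p"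
    and sym2: "\<And>i p. i < length w \<Longrightarrow> fst p \<noteq> 0 \<Longrightarrow> snd p \<noteq> 0 \<Longrightarrow> f i (neg2 p) = parity_sign (snd (w ! i)) * f i p"
  shows "\<exists>p. fst p \<noteq> 0 \<and> snd p \<noteq> 0 \<and> (\<forall>i<length w. f i p = 0)"
proof -
  let ?n = "DIM('e)"
  let ?P = "{p :: 'e \<times> 'e. fst p \<noteq> 0 \<and> snd p \<noteq> 0}"
  have n: "?n > 0" by simp
  obtain e :: "nat \<Rightarrow> 'e" where e: "bij_betw e {..<?n} Basis"
    using ex_bij_betw_nat_finite[OF finite_Basis] by (auto simp: atLeast0LessThan)
  have ortho: "e i \<bullet> e j = (if i = j then 1 else 0)" if "i < ?n" "j < ?n" for i j
    using e that bij_betwE[OF e] by (auto simp: inner_Basis bij_betw_def inj_on_eq_iff)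
  \<comment> \<open>At a zero of \<open>f i\<close> the odd signs of the two components are combined
    so that the parity is still \<open>w ! i\<close>.\<close>
  define \<sigma> where "\<sigma> i p = (if f i p = 0 then fst (w ! i) * lead_neg (fst p) + snd (w ! i) * lead_neg (snd p)
      else if f i p < 0 then 1 else 0)" for i p
  have ty: "has_type (\<sigma> i) (w ! i)" if i: "i < length w" for i
  proof -
    have "\<sigma> i (neg1 p) = \<sigma> i p + fst (w ! i)" if p: "fst p \<noteq> 0" "snd p \<noteq> 0" for p
      using sym1[OF i p] lead_neg_uminus[OF p(1)]
      by (cases "fst (w ! i)") (auto simp: \<sigma>_def parity_sign_def algebra_simps)
    moreover have "\<sigma> i (neg2 p) = \<sigma> i p + snd (w ! i)" if p: "fst p \<noteq> 0" "snd p \<noteq> 0" for p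
      using sym2[OF i p] lead_neg_uminus[OF p(2)]
      by (cases "snd (w ! i)") (auto simp: \<sigma>_def parity_sign_def algebra_simps)
    ultimately show ?thesis unfolding has_type_def by blast
  qed
  let ?ss = "map \<sigma> [0..<length w]" and ?H = "hemi e (?n - 1) (?n - 1)"
  have all2: "list_all2 has_type ?ss w"
    using ty by (simp add: list_all2_conv_all_nth)
  define K where "K = (\<Union>t\<in>set ?H. convex hull (set t))"
  have K: "compact K"
    unfolding K_def by (intro compact_UN finite_set compact_convex_hull finite_imp_compact)
  have KP: "K \<subseteq> ?P"
    using hemi_hull[OF ortho, where k = "?n - 1" and l = "?n - 1"] n unfolding K_def by auto
  define L where "L = 2 * ?n - 1"
  obtain D where D: "\<And>p q. p \<in> K \<Longrightarrow> q \<in> K \<Longrightarrow> dist p q \<le> D" "D \<ge> 0"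
    using that[of "diameter K"] diameter_bounded_bound[of K] diameter_ge_0[of K] compact_imp_bounded[OF K]
    by blast
  have "\<exists>s. cup ?ss s \<noteq> 0 \<and> set s \<subseteq> K \<and> length s = L \<and>
      (\<forall>p\<in>set s. \<forall>q\<in>set s. dist p q \<le> (1 - 1 / real L) ^ r * D)" for r
  proof -
    have "ev ((pull ^^ r) (cup ?ss)) ?H = 1"
      by (subst cup_eval[OF ortho all2]) (use n len coeff in auto)
    then obtain t where t: "t \<in> set ?H" "(pull ^^ r) (cup ?ss) t \<noteq> 0"
      using ev_nonzero[of "(pull ^^ r) (cup ?ss)" ?H] by auto
    have tK: "convex hull (set t) \<subseteq> K" unfolding K_def using t by blast
    have tL: "length t = L" using hemi_length[OF t(1)] n unfolding L_def by linarith
    have "dist p q \<le> D" if "p \<in> set t" "q \<in> set t" for p q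
      by (rule D(1); rule subsetD[OF tK]; rule hull_inc; fact that)
    from pull_nonzero[OF t(2) tL this D(2)] show ?thesis using tK by blast
  qed
  then obtain s where s: "\<And>r. cup ?ss (s r) \<noteq> 0" "\<And>r. set (s r) \<subseteq> K" "\<And>r. length (s r) = L"
    "\<And>r p q. p \<in> set (s r) \<Longrightarrow> q \<in> set (s r) \<Longrightarrow> dist p q \<le> (1 - 1 / real L) ^ r * D"
    by metis
  have L: "L > 0" using n unfolding L_def by linarith
  define z where "z r = hd (s r)" for r
  have z: "z r \<in> set (s r)" for r
    unfolding z_def using s(3)[of r] L by (intro hd_in_set) auto
  obtain x \<rho> where x: "x \<in> K" "strict_mono (\<rho> :: nat \<Rightarrow> nat)" "(z \<circ> \<rho>) \<longlonglongrightarrow> x"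
    using K z s(2) unfolding compact_def by (metis subsetD)
  have "(\<lambda>r. (1 - 1 / real L) ^ r * D) \<longlonglongrightarrow> 0 * D"
    using L by (intro tendsto_mult LIMSEQ_power_zero tendsto_const) auto
  then have mesh: "(\<lambda>r. (1 - 1 / real L) ^ \<rho> r * D) \<longlonglongrightarrow> 0"
    using LIMSEQ_subseq_LIMSEQ[OF _ x(2)] by (fastforce simp: o_def)
  \<comment> \<open>Otherwise \<open>\<sigma> i\<close> would be constant near \<open>x\<close>, and
    hence on a small simplex close to \<open>x\<close>.\<close>
  have "f i x = 0" if i: "i < length w" for i
  proof (rule ccontr)
    assume nz: "f i x \<noteq> 0"
    have "open ?P"
      by (intro open_Collect_conj open_Collect_neq continuous_intros)
    then have "x \<in> interior ?P"
      using subsetD[OF KP x(1)] by (simp only: interior_open)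
    then have "isCont (f i) x" by (rule continuous_on_interior[OF cont[OF i]])
    then obtain \<delta> where \<delta>: "\<delta> > 0" "\<And>y. dist y x < \<delta> \<Longrightarrow> dist (f i y) (f i x) < \<bar>f i x\<bar>"
      using nz unfolding continuous_at_eps_delta by (meson zero_less_abs_iff)
    have "eventually (\<lambda>r. dist ((z \<circ> \<rho>) r) x < \<delta> / 2) sequentially"
      by (rule tendstoD[OF x(3)]) (use \<delta>(1) in simp)
    moreover have "eventually (\<lambda>r. (1 - 1 / real L) ^ \<rho> r * D < \<delta> / 2) sequentially"
      using mesh \<delta>(1) by (intro order_tendstoD) auto
    ultimately have "eventually (\<lambda>r. dist (z (\<rho> r)) x < \<delta> / 2 \<and> (1 - 1 / real L) ^ \<rho> r * D < \<delta> / 2) sequentially"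
      by eventually_elim simp
    then obtain r where r: "dist (z (\<rho> r)) x < \<delta> / 2" "(1 - 1 / real L) ^ \<rho> r * D < \<delta> / 2"
      by (auto simp: eventually_sequentially)
    have same: "\<sigma> i p = \<sigma> i x" if "p \<in> set (s (\<rho> r))" for p
    proof -
      have "dist p x \<le> dist p (z (\<rho> r)) + dist (z (\<rho> r)) x" by (rule dist_triangle)
      also have "\<dots> < \<delta> / 2 + \<delta> / 2"
        using s(4)[OF that z] r by linarith
      finally have "dist (f i p) (f i x) < \<bar>f i x\<bar>" using \<delta>(2) by simp
      then show ?thesis using nz by (auto simp: \<sigma>_def dist_real_def)
    qed
    obtain p q where "p \<in> set (s (\<rho> r))" "q \<in> set (s (\<rho> r))" "\<sigma> i p \<noteq> \<sigma> i q"
      using cup_nonzero[OF s(1)[of "\<rho> r"], of "\<sigma> i"] i by auto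
    then show False using same by simp
  qed
  then show ?thesis using KP x(1) by blast
qed

subsection \<open>Pencils of hyperplanes\<close>

text \<open>A pair $(a, b)$ in the product of the space with the reals stands for the affine functional
  $x \mapsto a \cdot x + b$, that is, for the inner product with $(x, 1)$.\<close>

definition pencil :: "'e::real_inner \<times> 'e \<Rightarrow> real \<Rightarrow> 'e" where
  "pencil p \<theta> = sin \<theta> *\<^sub>R snd p - cos \<theta> *\<^sub>R fst p"

definition gram :: "'e::real_inner \<times> 'e \<Rightarrow> real" where
  "gram p = (fst p \<bullet> fst p) * (snd p \<bullet> snd p) - (fst p \<bullet> snd p)\<^sup>2"

lemma pencil_simps [simp]:
  "pencil p 0 = - fst p" "pencil p pi = fst p" "pencil (- p) \<theta> = - pencil p \<theta>"
  "gram (- p) = gram p" "gram (neg1 p) = gram p" "gram (neg2 p) = gram p"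
  by (simp_all add: pencil_def gram_def)

lemma pencil_neg2: "pencil (neg2 p) \<theta> = - pencil p (pi - \<theta>)"
  by (simp add: pencil_def sin_diff cos_diff)

lemma pencil_nonzero:
  assumes "gram p \<noteq> 0" shows "pencil p \<theta> \<noteq> 0" "fst p \<noteq> 0"
proof -
  show U: "fst p \<noteq> 0" using assms by (auto simp: gram_def)
  show "pencil p \<theta> \<noteq> 0"
  proof
    assume 0: "pencil p \<theta> = 0"
    show False
    proof (cases "sin \<theta> = 0")
      case True
      then have "cos \<theta> \<noteq> 0" using sin_cos_squared_add[of \<theta>] by auto
      then show False using 0 True U by (simp add: pencil_def)
    next
      case False
      then have "snd p = (1 / sin \<theta>) *\<^sub>R (sin \<theta> *\<^sub>R snd p)" by simp
      also have "sin \<theta> *\<^sub>R snd p = cos \<theta> *\<^sub>R fst p"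
        using 0 by (simp add: pencil_def)
      finally have "snd p = (cos \<theta> / sin \<theta>) *\<^sub>R fst p" by simp
      then show False
        using assms by (simp add: gram_def power2_eq_square)
    qed
  qed
qed

text \<open>Three members of a pencil are linearly dependent. Within a half turn the signs of the
  sines are known, so two members decide the sign of a third.\<close>

lemma pencil_identity: "sin (b - a) *\<^sub>R pencil p c = sin (c - a) *\<^sub>R pencil p b + sin (b - c) *\<^sub>R pencil p a"
proof -
  have 1: "sin (b - a) * sin c = sin (c - a) * sin b + sin (b - c) * sin a"
    and 2: "sin (b - a) * cos c = sin (c - a) * cos b + sin (b - c) * cos a"
    unfolding sin_diff using sin_cos_squared_add[of c]
    by (simp_all add: algebra_simps)
  show ?thesis
    unfolding pencil_def scaleR_diff_right scaleR_scaleR 1 2 by (simp add: algebra_simps)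
qed

text \<open>As a function of the angle this is a sinusoid whose zeros are \<open>pi\<close> apart,
  so after turning positive it stays positive up to \<open>pi\<close>.\<close>

lemma pencil_pos:
  assumes "0 \<le> a" "a < b" "b \<le> c" "c \<le> pi" "pencil p a \<bullet> z < 0" "0 < pencil p b \<bullet> z"
  shows "0 < pencil p c \<bullet> z"
proof (cases "b = c")
  case False
  then have "sin (b - a) > 0" "sin (c - a) \<ge> 0" "sin (c - b) > 0"
    using assms by (auto intro!: sin_gt_zero sin_ge_zero)
  moreover have "sin (b - a) * (pencil p c \<bullet> z) = sin (c - a) * (pencil p b \<bullet> z) - sin (c - b) * (pencil p a \<bullet> z)"
    using arg_cong[OF pencil_identity[of b a p c], of "\<lambda>v. v \<bullet> z"] sin_minus[of "c - b"]
    by (simp add: inner_add_left)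
  moreover have "sin (c - b) * (pencil p a \<bullet> z) < 0" "sin (c - a) * (pencil p b \<bullet> z) \<ge> 0"
    using assms(5,6) calculation(2,3) by (auto intro: mult_pos_neg)
  ultimately show ?thesis by (smt (verit) zero_less_mult_pos)
qed (use assms in simp)

lemma pencil_neg:
  assumes "0 \<le> c" "c \<le> a" "a < b" "b \<le> pi" "pencil p a \<bullet> z < 0" "0 < pencil p b \<bullet> z"
  shows "pencil p c \<bullet> z < 0"
proof (cases "a = c")
  case False
  then have "sin (b - a) > 0" "sin (b - c) \<ge> 0" "sin (a - c) > 0"
    using assms by (auto intro!: sin_gt_zero sin_ge_zero)
  moreover have "sin (b - a) * (pencil p c \<bullet> z) = sin (b - c) * (pencil p a \<bullet> z) - sin (a - c) * (pencil p b \<bullet> z)"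
    using arg_cong[OF pencil_identity[of b a p c], of "\<lambda>v. v \<bullet> z"] sin_minus[of "a - c"]
    by (simp add: inner_add_left)
  moreover have "sin (a - c) * (pencil p b \<bullet> z) > 0" "sin (b - c) * (pencil p a \<bullet> z) \<le> 0"
    using assms(5,6) calculation(2,3) by (auto intro: mult_nonneg_nonpos)
  ultimately have "sin (b - a) * (pencil p c \<bullet> z) < 0" by linarith
  then show ?thesis using \<open>sin (b - a) > 0\<close> by (simp add: mult_less_0_iff)
qed (use assms in simp)

locale ac_prob = prob_space \<mu> for \<mu> :: "'a::euclidean_space measure" +
  assumes sets_eq [measurable_cong]: "sets \<mu> = sets borel"
    and ac: "absolutely_continuous lborel \<mu>"
begin

lemma space_eq [simp]: "space \<mu> = UNIV"
  using sets_eq_imp_space_eq[OF sets_eq] by simp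

lemma null_hyperplane:
  fixes A :: "'a \<times> real"
  assumes "A \<noteq> 0" shows "{x. A \<bullet> (x, 1) = 0} \<in> null_sets \<mu>"
proof -
  let ?S = "{x. A \<bullet> (x, 1) = 0}"
  have S: "?S = {x. fst A \<bullet> x = - snd A}"
    by (auto simp: inner_prod_def)
  have "negligible ?S"
  proof (cases "fst A = 0")
    \<comment> \<open>A nonzero functional with zero linear part is a nonzero constant, and the set
      is empty.\<close>
    case True
    then have "snd A \<noteq> 0" using assms by (auto simp: prod_eq_iff)
    then show ?thesis using True by (simp add: S)
  next
    case False
    then show ?thesis unfolding S by (intro negligible_hyperplane) auto
  qed
  then have "?S \<in> null_sets lebesgue" by (simp add: negligible_iff_null_sets)
  moreover have "?S \<in> sets borel"
    unfolding S by (intro borel_closed closed_hyperplane)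
  ultimately have "?S \<in> null_sets lborel"
    by (simp add: null_sets_def)
  then show ?thesis using ac by (auto simp: absolutely_continuous_def)
qed

definition cap :: "'a \<times> real \<Rightarrow> 'a \<times> real \<Rightarrow> 'a set" where
  "cap A B = {x. 0 < A \<bullet> (x, 1) \<and> 0 < B \<bullet> (x, 1)}"

lemma open_cap [simp]: "open (cap A B)"
  unfolding cap_def by (intro open_Collect_conj open_Collect_less continuous_intros)

lemma sets_cap [simp, measurable]: "cap A B \<in> sets \<mu>"
  unfolding sets_eq by (intro borel_open open_cap)

text \<open>A point off both limiting hyperplanes eventually keeps its side. These hyperplanes are
  null sets, so the indicators converge almost everywhere and dominated convergence applies.\<close>

lemma continuous_prob_cap:
  "continuous_on {p. fst p \<noteq> 0 \<and> snd p \<noteq> 0} (\<lambda>p. prob (cap (fst p) (snd p)))"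
  unfolding continuous_on_sequentially
proof (intro allI ballI impI)
  fix q :: "nat \<Rightarrow> ('a \<times> real) \<times> ('a \<times> real)" and p
  assume "p \<in> {p. fst p \<noteq> 0 \<and> snd p \<noteq> 0}"
    and "(\<forall>n. q n \<in> {p. fst p \<noteq> 0 \<and> snd p \<noteq> 0}) \<and> q \<longlonglongrightarrow> p"
  then have p: "fst p \<noteq> 0" "snd p \<noteq> 0" and q: "q \<longlonglongrightarrow> p" by auto
  let ?i = "\<lambda>p x. indicator (cap (fst p) (snd p)) x :: real"
  have "(\<lambda>n. integral\<^sup>L \<mu> (?i (q n))) \<longlonglongrightarrow> integral\<^sup>L \<mu> (?i p)"
  proof (rule integral_dominated_convergence[where w = "\<lambda>_. 1"])
    have "AE x in \<mu>. fst p \<bullet> (x, 1) \<noteq> 0"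
      by (rule AE_I'[OF null_hyperplane[OF p(1)]]) auto
    moreover have "AE x in \<mu>. snd p \<bullet> (x, 1) \<noteq> 0"
      by (rule AE_I'[OF null_hyperplane[OF p(2)]]) auto
    ultimately show "AE x in \<mu>. (\<lambda>n. ?i (q n) x) \<longlonglongrightarrow> ?i p x"
    proof eventually_elim
      case (elim x)
      have ev: "eventually (\<lambda>n. (0 < F (q n) \<bullet> (x, 1)) = (0 < F p \<bullet> (x, 1))) sequentially"
        if "F p \<bullet> (x, 1) \<noteq> 0" "(\<lambda>n. F (q n)) \<longlonglongrightarrow> F p" for F :: "('a \<times> real) \<times> ('a \<times> real) \<Rightarrow> 'a \<times> real"
      proof -
        have *: "(\<lambda>n. F (q n) \<bullet> (x, 1)) \<longlonglongrightarrow> F p \<bullet> (x, 1)"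
          by (intro tendsto_intros that)
        show ?thesis
        proof (cases "0 < F p \<bullet> (x, 1)")
          case True
          show ?thesis using order_tendstoD(1)[OF * True] by eventually_elim (use True in simp)
        next
          case False
          then have "F p \<bullet> (x, 1) < 0" using that by simp
          from order_tendstoD(2)[OF * this] show ?thesis by eventually_elim (use False in simp)
        qed
      qed
      have "eventually (\<lambda>n. ?i (q n) x = ?i p x) sequentially"
        using ev[of fst, OF elim(1) tendsto_fst[OF q]] ev[of snd, OF elim(2) tendsto_snd[OF q]]
        by eventually_elim (simp add: cap_def indicator_def)
      then show ?case by (rule tendsto_eventually)
    qed
  qed (auto simp: indicator_def)
  then show "((\<lambda>p. prob (cap (fst p) (snd p))) \<circ> q) \<longlonglongrightarrow> prob (cap (fst p) (snd p))"
    by (simp add: o_def)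
qed

subsection \<open>Measures of double wedges\<close>

text \<open>As the angle runs from 0 to \<open>pi\<close>, the region grows from the empty set to
  the half-space where \<open>fst p\<close> is positive. The opposite half of the double wedge
  belongs to \<open>- p\<close>.\<close>

definition wedge :: "('a \<times> real) \<times> ('a \<times> real) \<Rightarrow> real \<Rightarrow> real" where
  "wedge p \<theta> = prob (cap (fst p) (pencil p \<theta>))"

definition dsum :: "('a \<times> real) \<times> ('a \<times> real) \<Rightarrow> real \<Rightarrow> real" where
  "dsum p \<theta> = wedge p \<theta> + wedge (- p) \<theta>"

definition ddiff :: "('a \<times> real) \<times> ('a \<times> real) \<Rightarrow> real \<Rightarrow> real" where
  "ddiff p \<theta> = wedge p \<theta> - wedge (- p) \<theta>"

lemma continuous_wedge:
  assumes "\<And>q. q \<in> S \<Longrightarrow> gram (g q) \<noteq> 0" "continuous_on S g" "continuous_on S h"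
  shows "continuous_on S (\<lambda>q. wedge (g q) (h q))"
proof -
  have "continuous_on S ((\<lambda>p. prob (cap (fst p) (snd p))) \<circ> (\<lambda>q. (fst (g q), pencil (g q) (h q))))"
  proof (rule continuous_on_compose)
    show "continuous_on S (\<lambda>q. (fst (g q), pencil (g q) (h q)))"
      unfolding pencil_def
      by (intro continuous_intros continuous_on_compose2[OF continuous_on_sin[OF continuous_on_id] assms(3)]
          continuous_on_compose2[OF continuous_on_cos[OF continuous_on_id] assms(3)] assms(2)) auto
    show "continuous_on ((\<lambda>q. (fst (g q), pencil (g q) (h q))) ` S) (\<lambda>p. prob (cap (fst p) (snd p)))"
    proof (rule continuous_on_subset[OF continuous_prob_cap], rule image_subsetI)
      fix q assume "q \<in> S"
      from pencil_nonzero[OF assms(1)[OF this]] show "(fst (g q), pencil (g q) (h q)) \<in> {p. fst p \<noteq> 0 \<and> snd p \<noteq> 0}"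
        by simp
    qed
  qed
  then show ?thesis by (simp add: wedge_def o_def)
qed

lemma continuous_dsum_ddiff:
  assumes "\<And>q. q \<in> S \<Longrightarrow> gram (g q) \<noteq> 0" "continuous_on S g" "continuous_on S h"
  shows "continuous_on S (\<lambda>q. dsum (g q) (h q))" "continuous_on S (\<lambda>q. ddiff (g q) (h q))"
  unfolding dsum_def ddiff_def using assms
  by (intro continuous_intros continuous_wedge; simp)+

lemma cap_pencil_mono:
  assumes "0 \<le> a" "a \<le> b" "b \<le> pi"
  shows "cap (fst p) (pencil p a) \<subseteq> cap (fst p) (pencil p b)"
proof
  fix x assume x: "x \<in> cap (fst p) (pencil p a)"
  have "a \<noteq> 0"
  proof
    assume "a = 0"
    then show False using x by (auto simp: cap_def)
  qed
  then show "x \<in> cap (fst p) (pencil p b)"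
    using x assms pencil_pos[of 0 a b p "(x, 1)"] by (cases "a = b") (auto simp: cap_def)
qed

lemma wedge_mono:
  assumes "0 \<le> a" "a \<le> b" "b \<le> pi"
  shows "wedge p a \<le> wedge p b"
  unfolding wedge_def by (intro finite_measure_mono cap_pencil_mono assms) simp

lemma wedge_0 [simp]: "wedge p 0 = 0"
proof -
  have "cap (fst p) (- fst p) = {}" by (auto simp: cap_def)
  then show ?thesis by (simp add: wedge_def)
qed

lemma prob_halfspace_split:
  assumes "A \<noteq> 0" shows "prob (cap B A) + prob (cap B (- A)) = prob (cap B B)"
proof -
  have "prob (cap B A) + prob (cap B (- A)) = prob (cap B A \<union> cap B (- A))"
    by (rule finite_measure_Union[symmetric]) (auto simp: cap_def)
  also have "\<dots> = prob (cap B B)"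
  proof (rule finite_measure_eq_AE)
    have "AE x in \<mu>. A \<bullet> (x, 1) \<noteq> 0"
      by (rule AE_I'[OF null_hyperplane[OF assms]]) auto
    then show "AE x in \<mu>. (x \<in> cap B A \<union> cap B (- A)) = (x \<in> cap B B)"
      by eventually_elim (auto simp: cap_def)
  qed auto
  finally show ?thesis .
qed

lemma dsum_0 [simp]: "dsum p 0 = 0" and ddiff_0 [simp]: "ddiff p 0 = 0"
  by (simp_all add: dsum_def ddiff_def)

lemma dsum_pi: "gram p \<noteq> 0 \<Longrightarrow> dsum p pi = 1"
proof -
  assume "gram p \<noteq> 0"
  then have 1: "fst p \<noteq> 0" by (rule pencil_nonzero)
  \<comment> \<open>\<open>(0, 1)\<close> is the constant functional 1, so splitting its positive
    set splits the whole space.\<close>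
  have "cap (0, 1) (fst p) = cap (fst p) (fst p)" "cap (0, 1) (- fst p) = cap (- fst p) (- fst p)"
    "cap (0, 1) (0, 1) = UNIV"
    by (auto simp: cap_def inner_prod_def)
  then show ?thesis
    using prob_halfspace_split[OF 1, of "(0, 1)"] prob_space by (simp add: dsum_def wedge_def)
qed

lemma wedge_neg2:
  assumes "gram p \<noteq> 0" shows "wedge (neg2 p) \<theta> = wedge p pi - wedge p (pi - \<theta>)"
  using prob_halfspace_split[OF pencil_nonzero(1)[OF assms], of "fst p" "pi - \<theta>"]
  by (simp add: wedge_def pencil_neg2)

lemma neg2_uminus: "- neg2 p = neg2 (- p)" "neg1 p = - neg2 p"
  by (simp_all add: neg2_def neg1_def prod_eq_iff)

lemma dsum_neg2: "gram p \<noteq> 0 \<Longrightarrow> dsum (neg2 p) \<theta> = 1 - dsum p (pi - \<theta>)"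
  and ddiff_neg2: "gram p \<noteq> 0 \<Longrightarrow> ddiff (neg2 p) \<theta> = ddiff p pi - ddiff p (pi - \<theta>)"
  using dsum_pi[of p] wedge_neg2[of p \<theta>] wedge_neg2[of "- p" \<theta>]
  by (simp_all add: dsum_def ddiff_def neg2_uminus)

lemma dsum_uminus [simp]: "dsum (- p) \<theta> = dsum p \<theta>"
  and ddiff_uminus [simp]: "ddiff (- p) \<theta> = - ddiff p \<theta>"
  by (simp_all add: dsum_def ddiff_def)

text \<open>Both wedge measures increase with the angle, so the difference of their increments is at
  most the sum.\<close>

lemma ddiff_lipschitz:
  assumes "a \<in> {0..pi}" "b \<in> {0..pi}"
  shows "\<bar>ddiff p a - ddiff p b\<bar> \<le> \<bar>dsum p a - dsum p b\<bar>"
proof (cases "a \<le> b")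
  case True
  then show ?thesis
    using wedge_mono[of a b p] wedge_mono[of a b "- p"] assms by (auto simp: ddiff_def dsum_def)
next
  case False
  then show ?thesis
    using wedge_mono[of b a p] wedge_mono[of b a "- p"] assms by (auto simp: ddiff_def dsum_def)
qed

lemma dsum_mono: "0 \<le> a \<Longrightarrow> a \<le> b \<Longrightarrow> b \<le> pi \<Longrightarrow> dsum p a \<le> dsum p b"
  unfolding dsum_def by (intro add_mono wedge_mono)

lemma dsum_surj:
  assumes "gram p \<noteq> 0" "t \<in> {0..1}"
  shows "\<exists>\<theta>\<in>{0..pi}. dsum p \<theta> = t"
proof -
  have "continuous_on {0..pi} (dsum p)"
    using continuous_dsum_ddiff(1)[of "{0..pi}" "\<lambda>_. p" "\<lambda>x. x"] assms by auto
  then show ?thesis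
    using IVT'[of "dsum p" 0 t pi] assms dsum_pi by auto
qed

text \<open>The angle chosen here need not be unique, but ddiff depends on it only through dsum, because
  ddiff is 1-Lipschitz with respect to dsum. This makes qdiff continuous in p without any positivity
  assumption on the density.\<close>

definition qdiff :: "('a \<times> real) \<times> ('a \<times> real) \<Rightarrow> real \<Rightarrow> real" where
  "qdiff p t = ddiff p (SOME \<theta>. \<theta> \<in> {0..pi} \<and> dsum p \<theta> = t)"

lemma qdiff_eq:
  assumes "\<theta> \<in> {0..pi}" "dsum p \<theta> = t" shows "qdiff p t = ddiff p \<theta>"
proof -
  let ?\<theta> = "SOME \<theta>. \<theta> \<in> {0..pi} \<and> dsum p \<theta> = t"
  have "?\<theta> \<in> {0..pi} \<and> dsum p ?\<theta> = t"
    by (rule someI[of _ \<theta>]) (use assms in simp)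
  then show ?thesis
    using ddiff_lipschitz[of ?\<theta> \<theta> p] assms by (simp add: qdiff_def)
qed

lemma qdiff_uminus: "gram p \<noteq> 0 \<Longrightarrow> t \<in> {0..1} \<Longrightarrow> qdiff (- p) t = - qdiff p t"
  using dsum_surj[of p t] qdiff_eq[of _ p t] qdiff_eq[of _ "- p" t] by force

lemma qdiff_neg2:
  assumes "gram p \<noteq> 0" "t \<in> {0..1}"
  shows "qdiff (neg2 p) t = ddiff p pi - qdiff p (1 - t)"
proof -
  obtain \<theta> where \<theta>: "\<theta> \<in> {0..pi}" "dsum p \<theta> = 1 - t"
    using dsum_surj[OF assms(1), of "1 - t"] assms(2) by auto
  have "qdiff (neg2 p) t = ddiff (neg2 p) (pi - \<theta>)"
    by (rule qdiff_eq) (use \<theta> in \<open>auto simp: dsum_neg2[OF assms(1)]\<close>)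
  then show ?thesis using qdiff_eq[OF \<theta>] by (simp add: ddiff_neg2[OF assms(1)])
qed

lemma qdiff_neg1:
  assumes "gram p \<noteq> 0" "t \<in> {0..1}"
  shows "qdiff (neg1 p) t = qdiff p (1 - t) - ddiff p pi"
  using qdiff_uminus[of "neg2 p" t] qdiff_neg2[of p t] assms by (simp add: neg2_uminus)

text \<open>Let the angles \<open>a\<close> and \<open>b\<close> give level \<open>t\<close> for
  \<open>p\<close> and \<open>q\<close>. Passing from \<open>a\<close> to \<open>b\<close> in
  \<open>ddiff p\<close> costs at most \<open>\<bar>dsum p b - dsum q b\<bar>\<close>. This and the
  change from \<open>p\<close> to \<open>q\<close> at angle \<open>b\<close> are small uniformly in
  the angle, since \<open>{0..pi}\<close> is compact.\<close>

lemma continuous_qdiff: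
  assumes t: "t \<in> {0..1}"
  shows "continuous_on {p. gram p \<noteq> 0} (\<lambda>p. qdiff p t)"
  unfolding continuous_on_iff
proof (intro ballI allI impI)
  let ?S = "{p :: ('a \<times> real) \<times> ('a \<times> real). gram p \<noteq> 0}"
  fix p :: "('a \<times> real) \<times> ('a \<times> real)" and e :: real
  assume p: "p \<in> ?S" and e: "0 < e"
  have C: "continuous_on (?S \<times> {0..pi}) (\<lambda>(p, \<theta>). dsum p \<theta>)" "continuous_on (?S \<times> {0..pi}) (\<lambda>(p, \<theta>). ddiff p \<theta>)"
    unfolding split_beta by (intro continuous_dsum_ddiff continuous_intros; auto)+
  have e3: "0 < e / 3" using e by simp
  obtain X where X: "p \<in> X" "open X" "\<forall>q\<in>X \<inter> ?S. \<forall>\<theta>\<in>{0..pi}. dist (dsum q \<theta>) (dsum p \<theta>) \<le> e / 3"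
    using continuous_on_prod_compactE[OF C(1) compact_Icc p e3] unfolding prod.case .
  obtain Y where Y: "p \<in> Y" "open Y" "\<forall>q\<in>Y \<inter> ?S. \<forall>\<theta>\<in>{0..pi}. dist (ddiff q \<theta>) (ddiff p \<theta>) \<le> e / 3"
    using continuous_on_prod_compactE[OF C(2) compact_Icc p e3] unfolding prod.case .
  have "open (X \<inter> Y)" "p \<in> X \<inter> Y" using X Y by auto
  then obtain d where d: "d > 0" "ball p d \<subseteq> X \<inter> Y"
    using openE by blast
  show "\<exists>d>0. \<forall>q\<in>?S. dist q p < d \<longrightarrow> dist (qdiff q t) (qdiff p t) < e"
  proof (intro exI[of _ d] conjI ballI impI d(1))
    fix q assume q: "q \<in> ?S" "dist q p < d"
    then have qXY: "q \<in> X \<inter> Y" using d by (auto simp: dist_commute)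
    obtain a where a: "a \<in> {0..pi}" "dsum p a = t" using dsum_surj[of p t] p t by auto
    obtain b where b: "b \<in> {0..pi}" "dsum q b = t" using dsum_surj[of q t] q t by auto
    have "\<bar>ddiff p b - ddiff p a\<bar> \<le> \<bar>dsum p b - dsum q b\<bar>"
      using ddiff_lipschitz[OF b(1) a(1), of p] a b by simp
    also have "\<dots> = dist (dsum q b) (dsum p b)" by (simp add: dist_real_def)
    also have "\<dots> \<le> e / 3" using X(3) qXY q b(1) by blast
    finally have "\<bar>ddiff p b - ddiff p a\<bar> \<le> e / 3" .
    moreover have "\<bar>ddiff q b - ddiff p b\<bar> \<le> e / 3"
      using Y(3) qXY q b(1) unfolding dist_real_def by blast
    ultimately show "dist (qdiff q t) (qdiff p t) < e"
      using e unfolding qdiff_eq[OF a] qdiff_eq[OF b] dist_real_def by linarith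
  qed
qed

end

section \<open>The test map of a fan and its common zeros\<close>

lemma lf_coeff_replicate1:
  "lf_coeff (replicate a (1, 0) @ w) k l = (if a \<le> k then lf_coeff w (k - a) l else 0)"
proof (induction a arbitrary: k)
  case (Suc a)
  then show ?case by (cases k; cases l) auto
qed simp

lemma lf_coeff_replicate2:
  "lf_coeff (replicate a (0, 1) @ w) k l = (if a \<le> l then lf_coeff w k (l - a) else 0)"
proof (induction a arbitrary: l)
  case (Suc a)
  then show ?case by (cases k; cases l) auto
qed simp

lemma continuous_on_mult_bounded:
  fixes g F :: "'t::real_normed_vector \<Rightarrow> real"
  assumes g: "continuous_on UNIV g" and F: "continuous_on {p. g p \<noteq> 0} F" and B: "\<And>p. \<bar>F p\<bar> \<le> B"
  shows "continuous_on UNIV (\<lambda>p. g p * F p)"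
proof (intro continuous_at_imp_continuous_on ballI)
  fix p
  have gp: "isCont g p" using g by (simp add: continuous_on_eq_continuous_at)
  show "isCont (\<lambda>p. g p * F p) p"
  proof (cases "g p = 0")
    case False
    have "open {p. g p \<noteq> 0}" by (intro open_Collect_neq g continuous_on_const)
    then have "isCont F p" using F False by (simp add: continuous_on_eq_continuous_at)
    then show ?thesis using gp by (intro continuous_intros)
  next
    case True
    have "((\<lambda>q. g q * F q) \<longlongrightarrow> 0) (at p)"
    proof (rule Lim_null_comparison)
      show "eventually (\<lambda>q. norm (g q * F q) \<le> \<bar>g q\<bar> * B) (at p)"
        by (intro always_eventually allI) (simp add: abs_mult mult_left_mono B)
      have "((\<lambda>q. \<bar>g q\<bar> * B) \<longlongrightarrow> \<bar>g p\<bar> * B) (at p)"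
        using gp unfolding isCont_def by (intro tendsto_intros)
      then show "((\<lambda>q. \<bar>g q\<bar> * B) \<longlongrightarrow> 0) (at p)" using True by simp
    qed
    then show ?thesis using True by (simp add: isCont_def)
  qed
qed

context ac_prob
begin

text \<open>The imbalances of the double wedges, counted from 0, so that reversal sends
  \<open>i\<close> to \<open>n - 1 - i\<close>.\<close>

definition cell :: "nat \<Rightarrow> ('a \<times> real) \<times> ('a \<times> real) \<Rightarrow> nat \<Rightarrow> real" where
  "cell n p i = qdiff p (real (Suc i) / real n) - qdiff p (real i / real n)"

lemma cell_bound: "\<bar>cell n p i\<bar> \<le> 2"
proof -
  have *: "\<bar>prob A - prob B\<bar> \<le> 1" for A B
    using prob_le_1[of A] prob_le_1[of B] measure_nonneg[of \<mu> A] measure_nonneg[of \<mu> B] by linarith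
  \<comment> \<open>Any angle gives a difference of two probabilities, so the bound survives an
    arbitrary choice in \<open>qdiff\<close> when \<open>gram p = 0\<close>.\<close>
  have "\<bar>qdiff p t\<bar> \<le> 1" for t
    unfolding qdiff_def ddiff_def wedge_def by (rule *)
  from this[of "real (Suc i) / real n"] this[of "real i / real n"] show ?thesis
    unfolding cell_def by linarith
qed

lemma cell_add_bound: "\<bar>cell n p i + cell n p j\<bar> \<le> 4" and cell_diff_bound: "\<bar>cell n p i - cell n p j\<bar> \<le> 4"
  using cell_bound[of n p i] cell_bound[of n p j] by linarith+

text \<open>Passing from \<open>t\<close> to \<open>1 - t\<close> reverses the \<open>n\<close>
  parts of the unit interval, and the constant \<open>ddiff p pi\<close> cancels in the
  differences.\<close>

lemma cell_neg:
  assumes "gram p \<noteq> 0" "i < n"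
  shows "cell n (neg1 p) i = - cell n p (n - 1 - i)" "cell n (neg2 p) i = cell n p (n - 1 - i)"
proof -
  have 01: "real (Suc i) / real n \<in> {0..1}" "real i / real n \<in> {0..1}"
    and 1: "1 - real (Suc i) / real n = real (n - 1 - i) / real n"
      "1 - real i / real n = real (Suc (n - 1 - i)) / real n"
    using assms(2) by (auto simp: field_simps)
  show "cell n (neg1 p) i = - cell n p (n - 1 - i)"
    using qdiff_neg1[OF assms(1) 01(1)] qdiff_neg1[OF assms(1) 01(2)] unfolding cell_def 1 by linarith
  show "cell n (neg2 p) i = cell n p (n - 1 - i)"
    using qdiff_neg2[OF assms(1) 01(1)] qdiff_neg2[OF assms(1) 01(2)] unfolding cell_def 1 by linarith
qed

lemma continuous_cell: "i < n \<Longrightarrow> continuous_on {p. gram p \<noteq> 0} (\<lambda>p. cell n p i)"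
  unfolding cell_def by (intro continuous_on_diff continuous_qdiff) auto

text \<open>The Gram determinant extends the functions continuously to linearly dependent pairs. The zeros
  created in this way are harmless, since a nonzero orthogonal pair is independent.\<close>

definition fan_fun :: "nat \<Rightarrow> nat \<Rightarrow> ('a \<times> real) \<times> ('a \<times> real) \<Rightarrow> real" where
  "fan_fun d i p =
    (if i < d then gram p * (cell (2 * d - 1) p i + cell (2 * d - 1) p (2 * d - 2 - i))
     else if i < 2 * d - 1 then gram p * (cell (2 * d - 1) p (i - d) - cell (2 * d - 1) p (2 * d - 2 - (i - d)))
     else fst p \<bullet> snd p)"

lemma continuous_gram: "continuous_on S gram"
  unfolding gram_def by (intro continuous_intros)

lemma continuous_fan_fun:
  assumes "d > 0" shows "continuous_on UNIV (fan_fun d i)"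
proof -
  consider "i < d" | "d \<le> i" "i < 2 * d - 1" | "2 * d - 1 \<le> i" by linarith
  then show ?thesis
  proof cases
    case 1
    have "continuous_on UNIV (\<lambda>p. gram p * (cell (2 * d - 1) p i + cell (2 * d - 1) p (2 * d - 2 - i)))"
    proof (rule continuous_on_mult_bounded[OF continuous_gram])
      show "continuous_on {p. gram p \<noteq> 0} (\<lambda>p. cell (2 * d - 1) p i + cell (2 * d - 1) p (2 * d - 2 - i))"
        by (intro continuous_on_add continuous_cell) (use 1 in linarith)+
    qed (rule cell_add_bound)
    then show ?thesis unfolding fan_fun_def[abs_def] using 1 by (simp only: if_True)
  next
    case 2
    have "continuous_on UNIV (\<lambda>p. gram p * (cell (2 * d - 1) p (i - d) - cell (2 * d - 1) p (2 * d - 2 - (i - d))))"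
    proof (rule continuous_on_mult_bounded[OF continuous_gram])
      show "continuous_on {p. gram p \<noteq> 0} (\<lambda>p. cell (2 * d - 1) p (i - d) - cell (2 * d - 1) p (2 * d - 2 - (i - d)))"
        by (intro continuous_on_diff continuous_cell) (use 2 in linarith)+
    qed (rule cell_diff_bound)
    then show ?thesis unfolding fan_fun_def[abs_def] using 2 by (simp only: if_True if_False not_less[symmetric])
  next
    case 3
    have "continuous_on UNIV (\<lambda>p :: ('a \<times> real) \<times> ('a \<times> real). fst p \<bullet> snd p)"
      by (intro continuous_intros)
    moreover have "\<not> i < d" "\<not> i < 2 * d - 1" using 3 assms by linarith+
    ultimately show ?thesis unfolding fan_fun_def[abs_def] by (simp only: if_False)
  qed
qed

text \<open>The linear factors of x^d y^(d-1) (x + y), in the order of the functions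
  \<open>fan_fun d i\<close>.\<close>

definition fan_types :: "nat \<Rightarrow> (bit \<times> bit) list" where
  "fan_types d = replicate d (1, 0) @ replicate (d - 1) (0, 1) @ [(1, 1)]"

lemma fan_types_nth:
  assumes "d > 0" "i < 2 * d"
  shows "fan_types d ! i = (if i < d then (1, 0) else if i < 2 * d - 1 then (0, 1) else (1, 1))"
proof -
  consider "i < d" | "d \<le> i" "i < 2 * d - 1" | "i = 2 * d - 1" "\<not> i < d" using assms by linarith
  then show ?thesis
    by cases (use assms in \<open>auto simp: fan_types_def nth_append\<close>)
qed

lemma gram_neg: "gram (neg1 p) = gram p" "gram (neg2 p) = gram p"
  by simp_all

lemma fan_fun_neg:
  assumes "d > 0" "i < 2 * d"
  shows "fan_fun d i (neg1 p) = parity_sign (fst (fan_types d ! i)) * fan_fun d i p"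
    "fan_fun d i (neg2 p) = parity_sign (snd (fan_types d ! i)) * fan_fun d i p"
proof -
  let ?n = "2 * d - 1"
  have c: "gram p * cell ?n (neg1 p) j = - (gram p * cell ?n p (2 * d - 2 - j))"
    "gram p * cell ?n (neg2 p) j = gram p * cell ?n p (2 * d - 2 - j)"
    "gram p * cell ?n (neg1 p) (2 * d - 2 - j) = - (gram p * cell ?n p j)"
    "gram p * cell ?n (neg2 p) (2 * d - 2 - j) = gram p * cell ?n p j" if j: "j < ?n" for j
  proof -
    have m: "?n - 1 - j = 2 * d - 2 - j" "?n - 1 - (2 * d - 2 - j) = j" "2 * d - 2 - j < ?n"
      using j by linarith+
    note cell = cell_neg[of p, OF _ j, unfolded m(1)] cell_neg[of p, OF _ m(3), unfolded m(2)]
    show "gram p * cell ?n (neg1 p) j = - (gram p * cell ?n p (2 * d - 2 - j))"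
      "gram p * cell ?n (neg2 p) j = gram p * cell ?n p (2 * d - 2 - j)"
      "gram p * cell ?n (neg1 p) (2 * d - 2 - j) = - (gram p * cell ?n p j)"
      "gram p * cell ?n (neg2 p) (2 * d - 2 - j) = gram p * cell ?n p j"
      using cell by (cases "gram p = 0"; simp only: mult_zero_left minus_zero mult_minus_right not_False_eq_True)+
  qed
  consider "i < d" | "d \<le> i" "i < ?n" | "i = ?n" "\<not> i < d" using assms by linarith
  then have "fan_fun d i (neg1 p) = parity_sign (fst (fan_types d ! i)) * fan_fun d i p \<and>
    fan_fun d i (neg2 p) = parity_sign (snd (fan_types d ! i)) * fan_fun d i p"
  proof cases
    case 1
    then have f: "fan_fun d i q = gram q * cell ?n q i + gram q * cell ?n q (2 * d - 2 - i)" for q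
      by (simp only: fan_fun_def if_True distrib_left)
    have t: "fan_types d ! i = (1, 0)" using 1 by (simp only: fan_types_nth[OF assms] if_True)
    have "i < ?n" using 1 by linarith
    then show ?thesis unfolding f gram_neg t c[OF \<open>i < ?n\<close>] parity_sign_def by simp
  next
    case 2
    then have f: "fan_fun d i q = gram q * cell ?n q (i - d) - gram q * cell ?n q (2 * d - 2 - (i - d))" for q
      by (simp only: fan_fun_def if_False if_True not_less[symmetric] right_diff_distrib)
    have t: "fan_types d ! i = (0, 1)"
      using 2 by (simp only: fan_types_nth[OF assms] if_False if_True not_less[symmetric])
    have "i - d < ?n" using 2 by linarith
    then show ?thesis unfolding f gram_neg t c[OF \<open>i - d < ?n\<close>] parity_sign_def by simp
  next
    case 3
    then have f: "fan_fun d i q = fst q \<bullet> snd q" for q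
      by (simp only: fan_fun_def if_False less_irrefl)
    have "fan_types d ! i = (1, 1)"
      unfolding fan_types_nth[OF assms] using 3 by (simp only: if_False less_irrefl)
    then show ?thesis by (simp add: f parity_sign_def)
  qed
  then show "fan_fun d i (neg1 p) = parity_sign (fst (fan_types d ! i)) * fan_fun d i p"
    "fan_fun d i (neg2 p) = parity_sign (snd (fan_types d ! i)) * fan_fun d i p" by simp_all
qed

lemma exists_zero_cells:
  assumes d: "d = DIM('a)"
  shows "\<exists>p. gram p \<noteq> 0 \<and> (\<forall>i<2 * d - 1. cell (2 * d - 1) p i = 0)"
proof -
  have d0: "d > 0" using d by simp
  have "\<exists>p. fst p \<noteq> 0 \<and> snd p \<noteq> 0 \<and> (\<forall>i<length (fan_types d). fan_fun d i p = 0)"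
  proof (rule common_zero_product_spheres)
    show "length (fan_types d) = 2 * (DIM('a \<times> real) - 1)"
      using d d0 by (simp add: fan_types_def)
    \<comment> \<open>Removing d factors x and d - 1 factors y leaves the coefficient of y in x +
      y.\<close>
    have "lf_coeff (fan_types d) d d = 1"
      using d0 unfolding fan_types_def lf_coeff_replicate1 lf_coeff_replicate2 by simp
    then show "lf_coeff (fan_types d) (DIM('a \<times> real) - 1) (DIM('a \<times> real) - 1) = 1"
      using d by simp
  qed (use d0 in \<open>auto simp: fan_fun_neg fan_types_def intro: continuous_on_subset[OF continuous_fan_fun]\<close>)
  then obtain p where p: "fst p \<noteq> 0" "snd p \<noteq> 0" "\<And>i. i < 2 * d \<Longrightarrow> fan_fun d i p = 0"
    using d0 by (auto simp: fan_types_def)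
  have "fst p \<bullet> snd p = 0" 
  proof -
    have "\<not> 2 * d - 1 < d" "2 * d - 1 < 2 * d" using d0 by linarith+
    then show ?thesis using p(3)[of "2 * d - 1"] unfolding fan_fun_def by simp
  qed
  then have g: "gram p \<noteq> 0" using p(1,2) by (simp add: gram_def)
  let ?c = "cell (2 * d - 1) p"
  have plus: "?c i + ?c (2 * d - 2 - i) = 0" if "i < d" for i
    using p(3)[of i] that g by (simp add: fan_fun_def)
  have minus: "?c i - ?c (2 * d - 2 - i) = 0" if "i < d - 1" for i
  proof -
    have "i + d < 2 * d - 1" "i + d < 2 * d" "\<not> i + d < d" using that by linarith+
    then show ?thesis using p(3)[of "i + d"] g unfolding fan_fun_def by simp
  qed
  have low: "?c i = 0 \<and> ?c (2 * d - 2 - i) = 0" if "i < d" for i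
  proof (cases "i < d - 1")
    case True
    then show ?thesis using plus[OF that] minus[OF True] by linarith
  next
    case False
    \<comment> \<open>The middle cell is its own mirror image, so its sum equation alone makes it
      zero.\<close>
    then have "i = d - 1" using that by simp
    moreover have "2 * d - 2 - (d - 1) = d - 1" by simp
    ultimately show ?thesis using plus[OF that] by simp
  qed
  have "?c i = 0" if "i < 2 * d - 1" for i
  proof (cases "i < d")
    case False
    then have "2 * d - 2 - (2 * d - 2 - i) = i" "2 * d - 2 - i < d" using that by auto
    then show ?thesis using low[of "2 * d - 2 - i"] by simp
  qed (use low in simp)
  then show ?thesis using g by blast
qed

lemma exists_balanced_pencil:
  assumes n: "n = 2 * DIM('a) - 1"
  shows "\<exists>p \<theta>. gram p \<noteq> 0 \<and> \<theta> 0 = 0 \<and> \<theta> n = pi \<and> (\<forall>i<n. \<theta> i < \<theta> (Suc i)) \<and>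
    (\<forall>i\<le>n. wedge p (\<theta> i) = real i / (2 * real n) \<and> wedge (- p) (\<theta> i) = real i / (2 * real n))"
proof -
  have n0: "n > 0" using n DIM_positive[where 'a = 'a] by linarith
  obtain p where g: "gram p \<noteq> 0" and c: "\<And>i. i < n \<Longrightarrow> cell n p i = 0"
    using exists_zero_cells[OF refl] n by blast
  have q0: "qdiff p 0 = 0" using qdiff_eq[of 0 p 0] by simp
  have q: "qdiff p (real i / real n) = 0" if "i \<le> n" for i
    using that
  proof (induction i)
    case (Suc i)
    then show ?case using c[of i] by (simp add: cell_def)
  qed (simp add: q0)
  \<comment> \<open>Levels 0 and 1 may be attained at several angles; choosing 0 and
    \<open>pi\<close> makes the first and last hyperplanes coincide.\<close>
  have "\<forall>i. \<exists>\<theta>. i \<le> n \<longrightarrow> \<theta> \<in> {0..pi} \<and> dsum p \<theta> = real i / real n \<and> (i = 0 \<longrightarrow> \<theta> = 0) \<and> (i = n \<longrightarrow> \<theta> = pi)"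
  proof
    fix i
    consider "i = 0" | "i = n" | "0 < i" "i < n" | "i > n" by linarith
    then show "\<exists>\<theta>. i \<le> n \<longrightarrow> \<theta> \<in> {0..pi} \<and> dsum p \<theta> = real i / real n \<and> (i = 0 \<longrightarrow> \<theta> = 0) \<and> (i = n \<longrightarrow> \<theta> = pi)"
    proof cases
      case 3
      then show ?thesis using dsum_surj[OF g, of "real i / real n"] by auto
    qed (use n0 dsum_pi[OF g] in \<open>auto intro: exI[of _ 0] exI[of _ pi]\<close>)
  qed
  then obtain \<theta> where \<theta>: "\<And>i. i \<le> n \<Longrightarrow> \<theta> i \<in> {0..pi}" "\<And>i. i \<le> n \<Longrightarrow> dsum p (\<theta> i) = real i / real n"
    "\<theta> 0 = 0" "\<theta> n = pi"
    by (metis le0 order_refl)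
  have "\<theta> i < \<theta> (Suc i)" if "i < n" for i
  proof (rule ccontr)
    assume "\<not> \<theta> i < \<theta> (Suc i)"
    then have "dsum p (\<theta> (Suc i)) \<le> dsum p (\<theta> i)"
      using \<theta>(1)[of i] \<theta>(1)[of "Suc i"] that by (intro dsum_mono) auto
    then show False using \<theta>(2)[of i] \<theta>(2)[of "Suc i"] that n0 by (simp add: field_simps)
  qed
  moreover have "wedge p (\<theta> i) = real i / (2 * real n) \<and> wedge (- p) (\<theta> i) = real i / (2 * real n)" if "i \<le> n" for i
  proof -
    have "ddiff p (\<theta> i) = 0" using qdiff_eq[OF \<theta>(1,2)[OF that]] q[OF that] by simp
    then show ?thesis using \<theta>(2)[OF that] n0 by (simp add: dsum_def ddiff_def field_simps)
  qed
  ultimately show ?thesis using g \<theta>(3,4) by blast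
qed

end

subsection \<open>The sectors of a fan\<close>

lemma components_Union_open:
  assumes op: "\<And>C. C \<in> \<S> \<Longrightarrow> open C" and conn: "\<And>C. C \<in> \<S> \<Longrightarrow> connected C"
    and ne: "{} \<notin> \<S>" and dis: "disjoint \<S>"
  shows "components (\<Union>\<S>) = \<S>"
proof -
  have eq: "connected_component_set (\<Union>\<S>) x = C" if C: "C \<in> \<S>" "x \<in> C" for C x
  proof
    show "C \<subseteq> connected_component_set (\<Union>\<S>) x"
      using C conn by (intro connected_component_maximal) auto
    show "connected_component_set (\<Union>\<S>) x \<subseteq> C"
    proof (rule ccontr)
      let ?D = "connected_component_set (\<Union>\<S>) x" and ?R = "\<Union>(\<S> - {C})"
      assume "\<not> ?D \<subseteq> C"
      have sub: "?D \<subseteq> \<Union>\<S>" by (rule connected_component_subset)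
      have "C \<inter> D = {}" if "D \<in> \<S> - {C}" for D
        using pairwiseD[OF dis C(1), of D] that unfolding disjnt_def by blast
      then have dj: "C \<inter> ?R \<inter> ?D = {}" by blast
      have openR: "open ?R" using op by (intro open_Union) simp
      have cover: "?D \<subseteq> C \<union> ?R" using sub by blast
      have "C \<inter> ?D = {} \<or> ?R \<inter> ?D = {}"
        by (rule connectedD[OF connected_connected_component op[OF C(1)] openR dj cover])
      moreover have "x \<in> C \<inter> ?D" using C by auto
      ultimately have "?R \<inter> ?D = {}" by blast
      then show False using cover \<open>\<not> ?D \<subseteq> C\<close> by blast
    qed
  qed
  show ?thesis
  proof (intro set_eqI iffI)
    fix C assume "C \<in> components (\<Union>\<S>)"
    then obtain x where "x \<in> \<Union>\<S>" "C = connected_component_set (\<Union>\<S>) x" by (auto simp: components_def)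
    then show "C \<in> \<S>" using eq by auto
  next
    fix C assume C: "C \<in> \<S>"
    then obtain x where "x \<in> C" using ne by fastforce
    then show "C \<in> components (\<Union>\<S>)" using eq[OF C] C by (auto simp: components_def)
  qed
qed

text \<open>If no member of the pencil has zero linear part, the linear parts \<open>?u\<close> and
  \<open>?v\<close> are independent; the system is solved in the orthogonal basis \<open>?u\<close>,
  \<open>w\<close> of their span.\<close>

lemma two_functionals_surj:
  fixes p :: "('a::euclidean_space \<times> real) \<times> ('a \<times> real)"
  assumes nz: "\<And>\<phi>. 0 \<le> \<phi> \<Longrightarrow> \<phi> < pi \<Longrightarrow> fst (pencil p \<phi>) \<noteq> 0"
  shows "\<exists>x. fst p \<bullet> (x, 1) = s \<and> snd p \<bullet> (x, 1) = t"
proof -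
  let ?u = "fst (fst p)" and ?v = "fst (snd p)"
  define r where "r = (?u \<bullet> ?v) / (?u \<bullet> ?u)"
  define w where "w = ?v - r *\<^sub>R ?u"
  have u: "?u \<noteq> 0" using nz[of 0] by simp
  have "w \<noteq> 0"
  proof
    assume "w = 0"
    then have v: "?v = r *\<^sub>R ?u" by (simp add: w_def)
    \<comment> \<open>For \<open>?v = r *\<^sub>R ?u\<close> the member at angle
      \<open>pi / 2 - arctan r\<close> has linear part
      \<open>(cos (arctan r) * r - sin (arctan r)) *\<^sub>R ?u\<close>, which is zero.\<close>
    have "cos (arctan r) * r = sin (arctan r)"
      using tan_arctan[of r] cos_arctan_not_zero[of r] by (simp add: tan_def field_simps)
    then have "fst (pencil p (pi / 2 - arctan r)) = 0"
      by (simp add: pencil_def v sin_diff cos_diff)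
    then show False
      using nz[of "pi / 2 - arctan r"] arctan_bounded[of r] by simp
  qed
  have uw: "?u \<bullet> w = 0" using u by (simp add: w_def r_def inner_diff_right)
  have v: "?v = w + r *\<^sub>R ?u" by (simp add: w_def)
  define s' t' where "s' = s - snd (fst p)" and "t' = t - snd (snd p)"
  let ?x = "(s' / (?u \<bullet> ?u)) *\<^sub>R ?u + ((t' - r * s') / (w \<bullet> w)) *\<^sub>R w"
  have ux: "?u \<bullet> ?x = s'" using u uw by (simp add: inner_add_right)
  have wx: "w \<bullet> ?x = t' - r * s'"
    using \<open>w \<noteq> 0\<close> uw inner_commute[of w ?u] by (simp add: inner_add_right)
  have "?v \<bullet> ?x = t'"
    by (subst v) (simp only: inner_add_left inner_scaleR_left ux wx diff_add_cancel)
  with ux show ?thesis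
    by (intro exI[of _ ?x]) (simp add: inner_prod_def s'_def t'_def)
qed

context ac_prob
begin

context
  fixes p :: "('a \<times> real) \<times> ('a \<times> real)" and \<theta> :: "nat \<Rightarrow> real" and n :: nat
  assumes g: "gram p \<noteq> 0" and \<theta>0: "\<theta> 0 = 0" and \<theta>n: "\<theta> n = pi"
    and \<theta>_step: "\<And>i. i < n \<Longrightarrow> \<theta> i < \<theta> (Suc i)"
    and w: "\<And>i. i \<le> n \<Longrightarrow> wedge p (\<theta> i) = real i / (2 * real n)"
      "\<And>i. i \<le> n \<Longrightarrow> wedge (- p) (\<theta> i) = real i / (2 * real n)"
    and n: "n \<ge> 2"
begin

text \<open>Half of a double wedge: \<open>q = p\<close> gives the half where \<open>fst p\<close>
  is positive, \<open>q = - p\<close> the opposite one.\<close>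

definition sector :: "('a \<times> real) \<times> ('a \<times> real) \<Rightarrow> nat \<Rightarrow> 'a set" where
  "sector q j = cap (- pencil q (\<theta> j)) (pencil q (\<theta> (Suc j)))"

lemma \<theta>_mono: "i < j \<Longrightarrow> j \<le> n \<Longrightarrow> \<theta> i < \<theta> j"
proof (induction j)
  case (Suc j)
  then show ?case using \<theta>_step[of j] by (cases "i = j") auto
qed simp

lemma \<theta>_range: "i \<le> n \<Longrightarrow> 0 \<le> \<theta> i" "i \<le> n \<Longrightarrow> \<theta> i \<le> pi" "i < n \<Longrightarrow> \<theta> i < pi"
  using \<theta>_mono[of 0 i] \<theta>_mono[of i n] \<theta>0 \<theta>n by (auto simp: le_less)

lemma sector_pos:
  assumes "x \<in> sector q j" "j < n" "\<theta> (Suc j) \<le> c" "c \<le> pi"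
  shows "0 < pencil q c \<bullet> (x, 1)"
  by (rule pencil_pos[OF \<theta>_range(1) \<theta>_step[OF assms(2)] assms(3,4)])
    (use assms in \<open>auto simp: sector_def cap_def\<close>)

lemma sector_neg:
  assumes "x \<in> sector q j" "j < n" "0 \<le> c" "c \<le> \<theta> j"
  shows "pencil q c \<bullet> (x, 1) < 0"
  by (rule pencil_neg[OF assms(3,4) \<theta>_step[OF assms(2)] \<theta>_range(2)])
    (use assms in \<open>auto simp: sector_def cap_def\<close>)

lemma sector_side: "x \<in> sector q j \<Longrightarrow> j < n \<Longrightarrow> 0 < fst q \<bullet> (x, 1)"
  using sector_pos[of x q j pi] \<theta>_range(2)[of "Suc j"] by simp

lemma prob_sector:
  assumes q: "q \<in> {p, - p}" and j: "j < n"
  shows "prob (sector q j) = 1 / (2 * real n)"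
proof -
  let ?a = "pencil q (\<theta> j)" and ?b = "pencil q (\<theta> (Suc j))"
  have "?a \<noteq> 0" using q g pencil_nonzero(1)[of p] by auto
  have sub: "cap (fst q) ?a \<subseteq> cap (fst q) ?b"
    using \<theta>_step[OF j] \<theta>_range(1)[of j] \<theta>_range(2)[of "Suc j"] j by (intro cap_pencil_mono) auto
  have "prob (cap (fst q) ?b) = prob (cap (fst q) ?a \<union> sector q j)"
  proof (rule finite_measure_eq_AE)
    have "AE x in \<mu>. ?a \<bullet> (x, 1) \<noteq> 0"
      by (rule AE_I'[OF null_hyperplane[OF \<open>?a \<noteq> 0\<close>]]) auto
    then show "AE x in \<mu>. (x \<in> cap (fst q) ?b) = (x \<in> cap (fst q) ?a \<union> sector q j)"
    proof eventually_elim
      case (elim x)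
      then show ?case
        using subsetD[OF sub, of x] sector_side[of x q j] j by (auto simp: cap_def sector_def)
    qed
  qed (auto simp: sector_def)
  also have "\<dots> = prob (cap (fst q) ?a) + prob (sector q j)"
    by (rule finite_measure_Union) (auto simp: cap_def sector_def)
  finally have "prob (sector q j) = wedge q (\<theta> (Suc j)) - wedge q (\<theta> j)"
    by (simp add: wedge_def)
  also have "\<dots> = 1 / (2 * real n)"
    using q w[of j] w[of "Suc j"] j by (auto simp: field_simps)
  finally show ?thesis .
qed

lemma sector_nonempty: "q \<in> {p, - p} \<Longrightarrow> j < n \<Longrightarrow> \<exists>x. x \<in> sector q j"
proof (rule ccontr)
  assume "q \<in> {p, - p}" "j < n" "\<nexists>x. x \<in> sector q j"
  then show False using prob_sector[of q j] n by auto
qed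

text \<open>The sign of \<open>fst p\<close> distinguishes \<open>p\<close> from \<open>- p\<close>.
  For \<open>i < l\<close> the member at \<open>\<theta> l\<close> is positive on sector
  \<open>i\<close> and negative on sector \<open>l\<close>.\<close>

lemma sector_disjoint:
  assumes "x \<in> sector q j" "x \<in> sector r k" "q \<in> {p, - p}" "r \<in> {p, - p}" "j < n" "k < n"
  shows "q = r \<and> j = k"
proof -
  have "\<not> (0 < fst p \<bullet> (x, 1) \<and> 0 < fst (- p) \<bullet> (x, 1))" by simp
  then have qr: "q = r"
    using sector_side[OF assms(1,5)] sector_side[OF assms(2,6)] assms(3,4) by blast
  have False if "x \<in> sector q i" "x \<in> sector q l" "i < l" "l < n" for i l
  proof -
    have "\<theta> (Suc i) \<le> \<theta> l" using \<theta>_mono[of "Suc i" l] that by (cases "Suc i = l") auto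
    then have "0 < pencil q (\<theta> l) \<bullet> (x, 1)"
      using that \<theta>_range(2)[of l] by (intro sector_pos[of x q i]) auto
    moreover have "pencil q (\<theta> l) \<bullet> (x, 1) < 0"
      using that \<theta>_range(1)[of l] by (intro sector_neg[of x q l]) auto
    ultimately show False by simp
  qed
  then show ?thesis using assms qr by (metis linorder_neqE_nat)
qed

text \<open>The fan consists of the indices below \<open>n\<close>: index \<open>n\<close> repeats
  index 0, since \<open>pencil p pi = - pencil p 0\<close>.\<close>

definition line :: "nat \<Rightarrow> 'a set" where
  "line i = {x. pencil p (\<theta> i) \<bullet> (x, 1) = 0}"

lemma sector_lines:
  assumes "q \<in> {p, - p}" "x \<in> sector q j" "j < n" "i < n" shows "x \<notin> line i"
proof -
  have "pencil q (\<theta> i) \<bullet> (x, 1) \<noteq> 0"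
  proof (cases "i \<le> j")
    case True
    then have "\<theta> i \<le> \<theta> j" using \<theta>_mono[of i j] assms by (cases "i = j") auto
    then show ?thesis using sector_neg[OF assms(2,3) \<theta>_range(1)[of i]] assms(4) by simp
  next
    case False
    then have "\<theta> (Suc j) \<le> \<theta> i" using \<theta>_mono[of "Suc j" i] assms by (cases "Suc j = i") auto
    then show ?thesis using sector_pos[OF assms(2,3) _ \<theta>_range(2)[of i]] assms(4) by simp
  qed
  then show ?thesis using assms(1) by (auto simp: line_def)
qed

lemma sector_cover:
  assumes x: "\<And>i. i < n \<Longrightarrow> x \<notin> line i"
  shows "\<exists>q\<in>{p, - p}. \<exists>j<n. x \<in> sector q j"
proof -
  have nz: "pencil q (\<theta> i) \<bullet> (x, 1) \<noteq> 0" if "q \<in> {p, - p}" "i < n" for q i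
    using x[of i] that by (auto simp: line_def)
  have "fst p \<bullet> (x, 1) \<noteq> 0" using nz[of p 0] \<theta>0 n by simp
  then have "0 < fst p \<bullet> (x, 1) \<or> 0 < fst (- p) \<bullet> (x, 1)" by auto
  then obtain q where q: "q \<in> {p, - p}" "0 < fst q \<bullet> (x, 1)" by blast
  let ?P = "\<lambda>k. 0 < pencil q (\<theta> k) \<bullet> (x, 1)"
  \<comment> \<open>The first member positive at \<open>x\<close> bounds its sector. It is not
    member 0, which is \<open>- fst q\<close> and negative at \<open>x\<close>.\<close>
  define k where "k = (LEAST k. ?P k)"
  have Pn: "?P n" using q(2) \<theta>n by simp
  then have k: "?P k" "k \<le> n" unfolding k_def by (auto intro: LeastI Least_le)
  have "k \<noteq> 0"
  proof
    assume "k = 0"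
    then show False using k(1) \<theta>0 q(2) by simp
  qed
  then obtain j where j: "k = Suc j" by (cases k) auto
  then have "\<not> ?P j" using not_less_Least[of j ?P] by (simp add: k_def)
  then have "x \<in> sector q j"
    using nz[OF q(1), of j] k j by (simp add: sector_def cap_def)
  then show ?thesis using q j k by auto
qed

lemma components_lines:
  "components (- \<Union>(line ` {..<n})) = sector p ` {..<n} \<union> sector (- p) ` {..<n}"
    (is "_ = ?S")
proof -
  have "- \<Union>(line ` {..<n}) = \<Union>?S"
  proof (intro set_eqI iffI)
    fix x assume "x \<in> - \<Union>(line ` {..<n})"
    then have "\<exists>q\<in>{p, - p}. \<exists>j<n. x \<in> sector q j" by (intro sector_cover) blast
    then show "x \<in> \<Union>?S" by blast
  next
    fix x assume "x \<in> \<Union>?S"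
    then obtain q j where "q \<in> {p, - p}" "j < n" "x \<in> sector q j" by blast
    then show "x \<in> - \<Union>(line ` {..<n})" using sector_lines[of q x j] by blast
  qed
  also have "components (\<Union>?S) = ?S"
  proof (rule components_Union_open)
    have "convex (sector q j)" for q j
    proof -
      have "sector q j = {x. fst (pencil q (\<theta> j)) \<bullet> x < - snd (pencil q (\<theta> j))} \<inter>
          {x. fst (pencil q (\<theta> (Suc j))) \<bullet> x > - snd (pencil q (\<theta> (Suc j)))}"
        by (auto simp: sector_def cap_def inner_prod_def)
      then show ?thesis
        by (simp add: convex_Int convex_halfspace_lt convex_halfspace_gt)
    qed
    then show "connected C" if "C \<in> ?S" for C using that convex_connected by blast
    show "open C" if "C \<in> ?S" for C using that by (auto simp: sector_def)
    show "{} \<notin> ?S" using sector_nonempty[of p] sector_nonempty[of "- p"] by blast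
    show "disjoint ?S"
    proof (rule pairwiseI)
      fix C D assume "C \<in> ?S" "D \<in> ?S" "C \<noteq> D"
      then obtain q j r k where C: "C = sector q j" "q \<in> {p, - p}" "j < n"
        and D: "D = sector r k" "r \<in> {p, - p}" "k < n" by blast
      have False if "x \<in> C" "x \<in> D" for x
        using sector_disjoint[of x q j r k] that C D \<open>C \<noteq> D\<close> by simp
      then show "disjnt C D" unfolding disjnt_iff by blast
    qed
  qed
  finally show ?thesis .
qed

lemma card_components: "card (components (- \<Union>(line ` {..<n}))) = 2 * n"
proof -
  have inj: "inj_on (sector q) {..<n}" if q: "q \<in> {p, - p}" for q
  proof (rule inj_onI)
    fix j k assume *: "j \<in> {..<n}" "k \<in> {..<n}" "sector q j = sector q k"
    then obtain x where "x \<in> sector q j" using sector_nonempty[OF q, of j] by auto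
    then show "j = k" using sector_disjoint[of x q j q k] * q by simp
  qed
  have "p \<noteq> - p" using g by (auto simp: gram_def eq_neg_iff_add_eq_0 scaleR_2[symmetric])
  then have "sector p j \<noteq> sector (- p) k" if "j < n" "k < n" for j k
    using sector_nonempty[of p j] sector_disjoint[of _ p j "- p" k] that by blast
  then have "sector p ` {..<n} \<inter> sector (- p) ` {..<n} = {}" by blast
  then have "card (components (- \<Union>(line ` {..<n}))) = card (sector p ` {..<n}) + card (sector (- p) ` {..<n})"
    unfolding components_lines by (intro card_Un_disjoint) auto
  then show ?thesis using inj[of p] inj[of "- p"] by (simp add: card_image)
qed

text \<open>A member with zero linear part would be constant, yet it has opposite signs on sector
  \<open>j\<close> of \<open>p\<close> and of \<open>- p\<close> when \<open>\<phi>\<close> lies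
  outside the angular range of that sector.\<close>

lemma linear_part_nonzero:
  assumes "0 \<le> \<phi>" "\<phi> < pi" shows "fst (pencil p \<phi>) \<noteq> 0"
proof
  assume 0: "fst (pencil p \<phi>) = 0"
  have *: "pencil p \<phi> \<bullet> (x, 1) = snd (pencil p \<phi>)" for x
    using 0 by (simp add: inner_prod_def)
  \<comment> \<open>Of the first two sectors, one has \<open>\<phi>\<close> outside its open angular
    range; this is where \<open>n \<ge> 2\<close> enters.\<close>
  define j where "j = (if \<phi> \<le> \<theta> 1 then 1 else 0 :: nat)"
  have j: "j < n" "\<phi> \<le> \<theta> j \<or> \<theta> (Suc j) \<le> \<phi>" using n by (auto simp: j_def)
  obtain x y where xy: "x \<in> sector p j" "y \<in> sector (- p) j"
    using sector_nonempty[of p j] sector_nonempty[of "- p" j] j(1) by auto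
  show False
    using j(2)
  proof
    assume "\<phi> \<le> \<theta> j"
    then show False
      using sector_neg[OF xy(1) j(1) assms(1)] sector_neg[OF xy(2) j(1) assms(1)] * by simp
  next
    assume "\<theta> (Suc j) \<le> \<phi>"
    then show False
      using sector_pos[OF xy(1) j(1), of \<phi>] sector_pos[OF xy(2) j(1), of \<phi>] assms(2) * by simp
  qed
qed

lemma inj_line: "inj_on line {..<n}"
proof (rule inj_onI, rule ccontr)
  fix i j assume ij: "i \<in> {..<n}" "j \<in> {..<n}" "line i = line j" "i \<noteq> j"
  \<comment> \<open>With these values the member at \<open>\<theta> k\<close> equals
    \<open>sin (\<theta> k - \<theta> i)\<close> at \<open>x\<close>, so \<open>x\<close> lies on
    \<open>line i\<close> and on no other.\<close>
  obtain x where x: "fst p \<bullet> (x, 1) = sin (\<theta> i)" "snd p \<bullet> (x, 1) = cos (\<theta> i)"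
    using two_functionals_surj[OF linear_part_nonzero] by blast
  have *: "pencil p (\<theta> k) \<bullet> (x, 1) = sin (\<theta> k - \<theta> i)" for k
    by (simp add: pencil_def inner_diff_left x sin_diff)
  have "x \<in> line i" by (simp add: line_def *)
  then have "sin (\<theta> j - \<theta> i) = 0" unfolding ij(3) by (simp add: line_def *)
  moreover have "0 \<le> \<theta> i" "0 \<le> \<theta> j" "\<theta> i < pi" "\<theta> j < pi" using \<theta>_range ij by auto
  moreover have "\<theta> i < \<theta> j \<or> \<theta> j < \<theta> i"
  proof (cases "i < j")
    case True
    then show ?thesis using \<theta>_mono[of i j] ij(2) by simp
  next
    case False
    then show ?thesis using \<theta>_mono[of j i] ij(1,4) by simp
  qed
  moreover have "sin (\<theta> i - \<theta> j) = - sin (\<theta> j - \<theta> i)"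
    using sin_minus[of "\<theta> j - \<theta> i"] by simp
  ultimately show False
    using sin_gt_zero[of "\<theta> j - \<theta> i"] sin_gt_zero[of "\<theta> i - \<theta> j"] by linarith
qed

lemma line_is_hyperplane: "i < n \<Longrightarrow> is_hyperplane (line i)"
  unfolding is_hyperplane_def
  using linear_part_nonzero[OF \<theta>_range(1) \<theta>_range(3), of i]
  by (intro exI[of _ "fst (pencil p (\<theta> i))"] exI[of _ "- snd (pencil p (\<theta> i))"])
    (auto simp: line_def inner_prod_def)

lemma exists_fan:
  "\<exists>H F. finite H \<and> card H = n \<and> (\<forall>h\<in>H. is_hyperplane h) \<and> is_flat (int DIM('a) - 2) F \<and>
    (\<forall>h\<in>H. F \<subseteq> h) \<and> card (components (- \<Union>H)) = 2 * n \<and>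
    (\<forall>C\<in>components (- \<Union>H). prob C = 1 / (2 * real n))"
proof -
  let ?U = "{x. fst p \<bullet> (x, 1) = 0}" and ?V = "{x. snd p \<bullet> (x, 1) = 0}"
  have UV: "?U = {x. fst (fst p) \<bullet> x = - snd (fst p)}" "?V = {x. fst (snd p) \<bullet> x = - snd (snd p)}"
    by (auto simp: inner_prod_def)
  note surj = two_functionals_surj[OF linear_part_nonzero]
  have u: "fst (fst p) \<noteq> 0" using linear_part_nonzero[of 0] by simp
  \<comment> \<open>The hyperplane \<open>?V\<close> meets \<open>?U\<close> without containing it,
    so intersecting lowers the dimension by exactly one.\<close>
  have "?U \<inter> ?V \<noteq> {}" using surj[of 0 0] by auto
  moreover have "\<not> ?U \<subseteq> ?V" using surj[of 0 1] by auto
  ultimately have "aff_dim (?U \<inter> ?V) = int DIM('a) - 2"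
    using aff_dim_affine_Int_hyperplane[of ?U "fst (snd p)" "- snd (snd p)"]
      aff_dim_hyperplane[OF u, of "- snd (fst p)"] affine_hyperplane[of "fst (fst p)"]
    unfolding UV by simp
  moreover have "affine (?U \<inter> ?V)"
    unfolding UV by (intro affine_Int affine_hyperplane)
  ultimately have "is_flat (int DIM('a) - 2) (?U \<inter> ?V)" by (simp add: is_flat_def)
  moreover have "?U \<inter> ?V \<subseteq> line i" for i
    by (auto simp: line_def pencil_def inner_diff_left)
  moreover have "prob C = 1 / (2 * real n)" if "C \<in> components (- \<Union>(line ` {..<n}))" for C
    using that prob_sector[of p] prob_sector[of "- p"] unfolding components_lines by blast
  ultimately show ?thesis
    using card_components line_is_hyperplane card_image[OF inj_line]
    by (intro exI[of _ "line ` {..<n}"] exI[of _ "?U \<inter> ?V"]) auto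
qed

end

end

theorem theorem7:
  fixes \<mu> :: "'a::euclidean_space measure"
  assumes "DIM('a) \<ge> 2"
    and "prob_space \<mu>"
    and "sets \<mu> = sets borel"
    and "absolutely_continuous lborel \<mu>"
  shows "\<exists>H F. finite H \<and> card H = 2 * DIM('a) - 1
          \<and> (\<forall>h\<in>H. is_hyperplane h)
          \<and> is_flat (int DIM('a) - 2) F
          \<and> (\<forall>h\<in>H. F \<subseteq> h)
          \<and> card (components (- \<Union>H)) = 4 * DIM('a) - 2
          \<and> (\<forall>C\<in>components (- \<Union>H). measure \<mu> C = 1 / (4 * real DIM('a) - 2))"
proof -
  interpret ac_prob \<mu>
    using assms by (simp add: ac_prob_def ac_prob_axioms_def)
  let ?n = "2 * DIM('a) - 1"
  obtain p \<theta> where p: "gram p \<noteq> 0" "\<theta> 0 = 0" "\<theta> ?n = pi" "\<And>i. i < ?n \<Longrightarrow> \<theta> i < \<theta> (Suc i)"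
    "\<And>i. i \<le> ?n \<Longrightarrow> wedge p (\<theta> i) = real i / (2 * real ?n)"
    "\<And>i. i \<le> ?n \<Longrightarrow> wedge (- p) (\<theta> i) = real i / (2 * real ?n)"
    using exists_balanced_pencil[OF refl] by blast
  have "?n \<ge> 2" using assms(1) by linarith
  have n: "2 * ?n = 4 * DIM('a) - 2" "2 * real ?n = 4 * real DIM('a) - 2"
    using assms(1) by (auto simp: of_nat_diff)
  show ?thesis
    using exists_fan[OF p \<open>?n \<ge> 2\<close>] unfolding n .
qed

end
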